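(* Let $p>3$ be a prime. Suppose that the following statement holds for $p$: for every $n\ge1$ and every nonsingular $n\times n$ matrix $M$ over $\mathbb{F}_p$ with row vectors $a_1,\dots,a_n$, if $$\prod_{1\le i\le n}(1-g^{e_i})\cdot\prod_{1\le i\le n}(1-g^{a_i})=0\in\mathbb{F}_p[\mathbb{F}_p^n],$$ then also $$\prod_{1\le i\le n}(1-g^{e_i})\cdot\prod_{1\le i\le n}(1-g^{a_i})=0\in\mathbb{Z}[\mathbb{F}_p^n],$$ where $e_1,\dots,e_n$ are the standard basis vectors of $\mathbb{F}_p^n$. Then for every $n\ge 1$ and every nonsingular matrix $M\in M^{n\times n}(\mathbb{F}_p)$ there is a vector $x\in\mathbb{F}_p^n$ such that both $x$ and $Mx$ have only nonzero entries.
   Context: For a ring $R$, $R[\mathbb{F}_p^n]$ is the group ring of the additive group $\mathbb{F}_p^n$, written multiplicatively: $g^v$ denotes the group element $v\in\mathbb{F}_p^n$, so $g^vg^w=g^{v+w}$. *)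

theory Defs
  imports
    "HOL-Algebra.Ring"
    "Jordan_Normal_Form.Matrix"
    "Berlekamp_Zassenhaus.Finite_Field"
begin

text \<open>
  The group ring of a group \<open>G\<close> (written multiplicatively as a record) with coefficients in a
  type \<open>'r\<close>: finitely supported functions, extended by \<open>0\<close> outside \<open>carrier G\<close>, under
  convolution.
\<close>

definition group_ring :: "'r::comm_ring_1 itself \<Rightarrow> ('g, 'b) monoid_scheme \<Rightarrow> ('g \<Rightarrow> 'r) ring" where
  "group_ring ty G = \<lparr>
     carrier = {f. finite {x. f x \<noteq> 0} \<and> {x. f x \<noteq> 0} \<subseteq> carrier G},
     mult = (\<lambda>f h x. \<Sum>(u, v) \<in> {(u, v). f u \<noteq> 0 \<and> h v \<noteq> 0 \<and> u \<otimes>\<^bsub>G\<^esub> v = x}. f u * h v),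
     one = (\<lambda>x. if x = \<one>\<^bsub>G\<^esub> then 1 else 0),
     zero = (\<lambda>x. 0),
     add = (\<lambda>f h x. f x + h x)\<rparr>"

definition group_elem :: "'g \<Rightarrow> 'g \<Rightarrow> 'r::comm_ring_1" where
  "group_elem v = (\<lambda>x. if x = v then 1 else 0)"

abbreviation vec_group_ring ::
  "'r::comm_ring_1 itself \<Rightarrow> 'k::ab_group_add itself \<Rightarrow> nat \<Rightarrow> ('k vec \<Rightarrow> 'r) ring" where
  "vec_group_ring ty tk n \<equiv> group_ring ty (monoid_vec tk n)"

definition basis_row_product ::
  "'r::comm_ring_1 itself \<Rightarrow> nat \<Rightarrow> 'k::field mat \<Rightarrow> ('k vec \<Rightarrow> 'r)" where
  "basis_row_product ty n M =
     (let A = vec_group_ring ty TYPE('k) n in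
        (\<Otimes>\<^bsub>A\<^esub> i \<in> {..<n}. \<one>\<^bsub>A\<^esub> \<ominus>\<^bsub>A\<^esub> group_elem (unit_vec n i)) \<otimes>\<^bsub>A\<^esub>
        (\<Otimes>\<^bsub>A\<^esub> i \<in> {..<n}. \<one>\<^bsub>A\<^esub> \<ominus>\<^bsub>A\<^esub> group_elem (row M i)))"

text \<open>
  \<open>finprod\<close> and \<open>\<ominus>\<close> above are only meaningful in a commutative ring; the rest of this theory
  checks that \<open>group_ring\<close> is one whenever \<open>G\<close> is abelian.
\<close>

lemma group_ring_carrier_iff:
  "f \<in> carrier (group_ring TYPE('r::comm_ring_1) G) \<longleftrightarrow>
     finite {x. f x \<noteq> 0} \<and> {x. f x \<noteq> 0} \<subseteq> carrier G"
  by (simp add: group_ring_def)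

lemma group_ring_simps:
  "\<zero>\<^bsub>group_ring TYPE('r::comm_ring_1) G\<^esub> = (\<lambda>x. 0)"
  "\<one>\<^bsub>group_ring TYPE('r) G\<^esub> = group_elem \<one>\<^bsub>G\<^esub>"
  "f \<oplus>\<^bsub>group_ring TYPE('r) G\<^esub> h = (\<lambda>x. f x + h x)"
  by (simp_all add: group_ring_def group_elem_def)

lemma group_ring_mult_eq:
  fixes f h :: "'g \<Rightarrow> 'r::comm_ring_1"
  assumes "finite A" "finite B" "{x. f x \<noteq> 0} \<subseteq> A" "{x. h x \<noteq> 0} \<subseteq> B"
  shows "(f \<otimes>\<^bsub>group_ring TYPE('r) G\<^esub> h) x =
           (\<Sum>u\<in>A. \<Sum>v\<in>B. if u \<otimes>\<^bsub>G\<^esub> v = x then f u * h v else 0)"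
proof -
  have "(\<Sum>u\<in>A. \<Sum>v\<in>B. if u \<otimes>\<^bsub>G\<^esub> v = x then f u * h v else 0) =
        (\<Sum>(u, v)\<in>A \<times> B. if u \<otimes>\<^bsub>G\<^esub> v = x then f u * h v else 0)"
    by (simp add: sum.cartesian_product)
  also have "\<dots> = (\<Sum>(u, v) \<in> {(u, v). f u \<noteq> 0 \<and> h v \<noteq> 0 \<and> u \<otimes>\<^bsub>G\<^esub> v = x}. f u * h v)"
    using assms by (intro sum.mono_neutral_cong_right) (auto split: if_splits)
  finally show ?thesis by (simp add: group_ring_def)
qed

lemma group_ring_mult_closed:
  fixes G (structure) and f h :: "'g \<Rightarrow> 'r::comm_ring_1"
  assumes "monoid G"
    and f: "f \<in> carrier (group_ring TYPE('r) G)" and h: "h \<in> carrier (group_ring TYPE('r) G)"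
  shows "{x. (f \<otimes>\<^bsub>group_ring TYPE('r) G\<^esub> h) x \<noteq> 0} \<subseteq>
           (\<lambda>(u, v). u \<otimes> v) ` ({x. f x \<noteq> 0} \<times> {x. h x \<noteq> 0})"
    and "f \<otimes>\<^bsub>group_ring TYPE('r) G\<^esub> h \<in> carrier (group_ring TYPE('r) G)"
proof -
  interpret monoid G by fact
  let ?S = "(\<lambda>(u, v). u \<otimes> v) ` ({x. f x \<noteq> 0} \<times> {x. h x \<noteq> 0})"
  show sub: "{x. (f \<otimes>\<^bsub>group_ring TYPE('r) G\<^esub> h) x \<noteq> 0} \<subseteq> ?S"
  proof
    fix x assume "x \<in> {x. (f \<otimes>\<^bsub>group_ring TYPE('r) G\<^esub> h) x \<noteq> 0}"
    then have "(\<Sum>(u, v) \<in> {(u, v). f u \<noteq> 0 \<and> h v \<noteq> 0 \<and> u \<otimes> v = x}. f u * h v) \<noteq> 0"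
      by (simp add: group_ring_def)
    then obtain a where "a \<in> {(u, v). f u \<noteq> 0 \<and> h v \<noteq> 0 \<and> u \<otimes> v = x}"
      by (meson sum.not_neutral_contains_not_neutral)
    then show "x \<in> ?S" by force
  qed
  have "finite ?S" "?S \<subseteq> carrier G"
    using f h by (auto simp: group_ring_carrier_iff)
  then show "f \<otimes>\<^bsub>group_ring TYPE('r) G\<^esub> h \<in> carrier (group_ring TYPE('r) G)"
    unfolding group_ring_carrier_iff using sub by (meson finite_subset order_trans)
qed

lemma group_elem_closed:
  "v \<in> carrier G \<Longrightarrow> group_elem v \<in> carrier (group_ring TYPE('r::comm_ring_1) G)"
  by (auto simp: group_ring_carrier_iff group_elem_def)

lemma group_elem_mult:
  "(group_elem v \<otimes>\<^bsub>group_ring TYPE('r::comm_ring_1) G\<^esub> group_elem w) = group_elem (v \<otimes>\<^bsub>G\<^esub> w)"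
  by (rule ext, subst group_ring_mult_eq[of "{v}" "{w}"]) (auto simp: group_elem_def)

lemma group_ring_mult_assoc:
  fixes G (structure) and f h k :: "'g \<Rightarrow> 'r::comm_ring_1"
  defines "R \<equiv> group_ring TYPE('r) G"
  assumes "monoid G" and f: "f \<in> carrier R" and h: "h \<in> carrier R" and k: "k \<in> carrier R"
  shows "(f \<otimes>\<^bsub>R\<^esub> h) \<otimes>\<^bsub>R\<^esub> k = f \<otimes>\<^bsub>R\<^esub> (h \<otimes>\<^bsub>R\<^esub> k)"
proof
  fix x
  interpret monoid G by fact
  define A B C where "A = {x. f x \<noteq> 0}" and "B = {x. h x \<noteq> 0}" and "C = {x. k x \<noteq> 0}"
  define AB BC where "AB = (\<lambda>(u, v). u \<otimes> v) ` (A \<times> B)" and "BC = (\<lambda>(u, v). u \<otimes> v) ` (B \<times> C)"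
  have fin: "finite A" "finite B" "finite C" and sub: "A \<subseteq> carrier G" "B \<subseteq> carrier G" "C \<subseteq> carrier G"
    using f h k by (auto simp: R_def group_ring_carrier_iff A_def B_def C_def)
  then have finAB: "finite AB" "finite BC" by (auto simp: AB_def BC_def)
  have sAB: "{x. (f \<otimes>\<^bsub>R\<^esub> h) x \<noteq> 0} \<subseteq> AB" and sBC: "{x. (h \<otimes>\<^bsub>R\<^esub> k) x \<noteq> 0} \<subseteq> BC"
    using group_ring_mult_closed(1)[OF \<open>monoid G\<close>] f h k
    unfolding R_def AB_def BC_def A_def B_def C_def by blast+
  have "((f \<otimes>\<^bsub>R\<^esub> h) \<otimes>\<^bsub>R\<^esub> k) x =
      (\<Sum>w\<in>AB. \<Sum>c\<in>C. if w \<otimes> c = x then (\<Sum>a\<in>A. \<Sum>b\<in>B. if a \<otimes> b = w then f a * h b else 0) * k c else 0)"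
    unfolding R_def using sAB finAB fin
    by (subst group_ring_mult_eq[of AB C])
       (auto simp: R_def C_def A_def B_def group_ring_mult_eq[of A B] intro!: sum.cong)
  also have "\<dots> = (\<Sum>w\<in>AB. \<Sum>c\<in>C. \<Sum>a\<in>A. \<Sum>b\<in>B.
      if a \<otimes> b = w then (if w \<otimes> c = x then f a * h b * k c else 0) else 0)"
    by (auto simp: sum_distrib_right intro!: sum.cong cong: if_cong)
  also have "\<dots> = (\<Sum>c\<in>C. \<Sum>a\<in>A. \<Sum>b\<in>B. \<Sum>w\<in>AB.
      if a \<otimes> b = w then (if w \<otimes> c = x then f a * h b * k c else 0) else 0)"
    by (subst sum.swap[of _ _ AB])+ simp
  also have "\<dots> = (\<Sum>c\<in>C. \<Sum>a\<in>A. \<Sum>b\<in>B. if a \<otimes> b \<otimes> c = x then f a * h b * k c else 0)"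
    using finAB by (intro sum.cong refl, subst sum.delta') (auto simp: AB_def)
  also have "\<dots> = (\<Sum>a\<in>A. \<Sum>b\<in>B. \<Sum>c\<in>C. if a \<otimes> b \<otimes> c = x then f a * h b * k c else 0)"
    by (subst sum.swap[of _ _ C])+ simp
  also have "\<dots> = (\<Sum>a\<in>A. \<Sum>b\<in>B. \<Sum>c\<in>C. if a \<otimes> (b \<otimes> c) = x then f a * h b * k c else 0)"
    using sub by (intro sum.cong refl) (subst m_assoc, auto)
  also have "\<dots> = (\<Sum>a\<in>A. \<Sum>b\<in>B. \<Sum>c\<in>C. \<Sum>w\<in>BC.
      if b \<otimes> c = w then (if a \<otimes> w = x then f a * h b * k c else 0) else 0)"
    using finAB by (intro sum.cong refl, subst sum.delta') (auto simp: BC_def)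
  also have "\<dots> = (\<Sum>a\<in>A. \<Sum>w\<in>BC. \<Sum>b\<in>B. \<Sum>c\<in>C.
      if b \<otimes> c = w then (if a \<otimes> w = x then f a * h b * k c else 0) else 0)"
    by (subst sum.swap[of _ BC])+ simp
  also have "\<dots> = (\<Sum>a\<in>A. \<Sum>w\<in>BC.
      if a \<otimes> w = x then f a * (\<Sum>b\<in>B. \<Sum>c\<in>C. if b \<otimes> c = w then h b * k c else 0) else 0)"
    by (auto simp: sum_distrib_left mult.assoc intro!: sum.cong cong: if_cong)
  also have "\<dots> = (f \<otimes>\<^bsub>R\<^esub> (h \<otimes>\<^bsub>R\<^esub> k)) x"
    unfolding R_def using sBC finAB fin
    by (subst group_ring_mult_eq[of A BC])
       (auto simp: R_def C_def A_def B_def group_ring_mult_eq[of B C] intro!: sum.cong)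
  finally show "((f \<otimes>\<^bsub>R\<^esub> h) \<otimes>\<^bsub>R\<^esub> k) x = (f \<otimes>\<^bsub>R\<^esub> (h \<otimes>\<^bsub>R\<^esub> k)) x" .
qed

lemma group_ring_mult_comm:
  fixes G (structure) and f h :: "'g \<Rightarrow> 'r::comm_ring_1"
  defines "R \<equiv> group_ring TYPE('r) G"
  assumes "comm_monoid G" and f: "f \<in> carrier R" and h: "h \<in> carrier R"
  shows "f \<otimes>\<^bsub>R\<^esub> h = h \<otimes>\<^bsub>R\<^esub> f"
proof
  fix x
  interpret comm_monoid G by fact
  define A B where "A = {x. f x \<noteq> 0}" and "B = {x. h x \<noteq> 0}"
  have fin: "finite A" "finite B" and sub: "A \<subseteq> carrier G" "B \<subseteq> carrier G"
    using f h by (auto simp: R_def group_ring_carrier_iff A_def B_def)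
  have "(f \<otimes>\<^bsub>R\<^esub> h) x = (\<Sum>u\<in>A. \<Sum>v\<in>B. if u \<otimes> v = x then f u * h v else 0)"
    unfolding R_def using fin by (intro group_ring_mult_eq) (auto simp: A_def B_def)
  also have "\<dots> = (\<Sum>v\<in>B. \<Sum>u\<in>A. if u \<otimes> v = x then f u * h v else 0)"
    by (rule sum.swap)
  also have "\<dots> = (\<Sum>v\<in>B. \<Sum>u\<in>A. if v \<otimes> u = x then h v * f u else 0)"
    using sub by (intro sum.cong refl) (subst m_comm, auto simp: mult.commute)
  also have "\<dots> = (h \<otimes>\<^bsub>R\<^esub> f) x"
    unfolding R_def using fin by (intro group_ring_mult_eq[symmetric]) (auto simp: A_def B_def)
  finally show "(f \<otimes>\<^bsub>R\<^esub> h) x = (h \<otimes>\<^bsub>R\<^esub> f) x" .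
qed

lemma group_ring_cring:
  fixes G (structure)
  assumes "comm_group G"
  shows "cring (group_ring TYPE('r::comm_ring_1) G)" (is "cring ?R")
proof -
  interpret comm_group G by fact
  have fin_add: "f \<oplus>\<^bsub>?R\<^esub> h \<in> carrier ?R" if "f \<in> carrier ?R" "h \<in> carrier ?R" for f h
  proof -
    have "{x. f x + h x \<noteq> 0} \<subseteq> {x. f x \<noteq> 0} \<union> {x. h x \<noteq> 0}" by auto
    with that show ?thesis
      by (auto simp: group_ring_carrier_iff group_ring_simps intro: finite_subset)
  qed
  show ?thesis
  proof (rule cringI)
    show "abelian_group ?R"
    proof (rule abelian_groupI)
      fix f assume "f \<in> carrier ?R"
      then show "\<exists>y\<in>carrier ?R. y \<oplus>\<^bsub>?R\<^esub> f = \<zero>\<^bsub>?R\<^esub>"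
        by (intro bexI[of _ "\<lambda>x. - f x"]) (auto simp: group_ring_carrier_iff group_ring_simps)
    qed (use fin_add in \<open>auto simp: group_ring_simps group_ring_carrier_iff add_ac\<close>)
    show "comm_monoid ?R"
    proof (rule comm_monoidI)
      show "\<one>\<^bsub>?R\<^esub> \<in> carrier ?R" by (simp add: group_ring_simps group_elem_closed)
      fix f assume f: "f \<in> carrier ?R"
      show "\<one>\<^bsub>?R\<^esub> \<otimes>\<^bsub>?R\<^esub> f = f"
      proof
        fix x
        have fin: "finite {x. f x \<noteq> 0}" and sub: "{x. f x \<noteq> 0} \<subseteq> carrier G"
          using f by (auto simp: group_ring_carrier_iff)
        have "(\<one>\<^bsub>?R\<^esub> \<otimes>\<^bsub>?R\<^esub> f) x = (\<Sum>v | f v \<noteq> 0. if \<one> \<otimes> v = x then f v else 0)"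
          using fin by (subst group_ring_mult_eq[of "{\<one>}" "{x. f x \<noteq> 0}"])
            (auto simp: group_ring_simps group_elem_def intro!: sum.cong)
        also have "\<dots> = (\<Sum>v | f v \<noteq> 0. if v = x then f v else 0)"
          using sub by (intro sum.cong refl) (subst l_one, auto)
        also have "\<dots> = f x" using fin by simp
        finally show "(\<one>\<^bsub>?R\<^esub> \<otimes>\<^bsub>?R\<^esub> f) x = f x" .
      qed
    qed (use group_ring_mult_closed(2) group_ring_mult_assoc group_ring_mult_comm
          comm_monoid_axioms monoid_axioms in blast)+
    fix f h k assume f: "f \<in> carrier ?R" and h: "h \<in> carrier ?R" and k: "k \<in> carrier ?R"
    define A C where "A = {x. f x \<noteq> 0} \<union> {x. h x \<noteq> 0}" and "C = {x. k x \<noteq> 0}"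
    have fin: "finite A" "finite C"
      using f h k by (auto simp: group_ring_carrier_iff A_def C_def)
    have eq: "(g \<otimes>\<^bsub>?R\<^esub> k) x = (\<Sum>u\<in>A. \<Sum>v\<in>C. if u \<otimes> v = x then g u * k v else 0)"
      if "{x. g x \<noteq> 0} \<subseteq> A" for g x
      using fin that by (intro group_ring_mult_eq) (auto simp: C_def)
    show "(f \<oplus>\<^bsub>?R\<^esub> h) \<otimes>\<^bsub>?R\<^esub> k = f \<otimes>\<^bsub>?R\<^esub> k \<oplus>\<^bsub>?R\<^esub> h \<otimes>\<^bsub>?R\<^esub> k"
    proof
      fix x
      have "{x. (f \<oplus>\<^bsub>?R\<^esub> h) x \<noteq> 0} \<subseteq> A" "{x. f x \<noteq> 0} \<subseteq> A" "{x. h x \<noteq> 0} \<subseteq> A"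
        by (auto simp: group_ring_simps A_def)
      then show "((f \<oplus>\<^bsub>?R\<^esub> h) \<otimes>\<^bsub>?R\<^esub> k) x = (f \<otimes>\<^bsub>?R\<^esub> k \<oplus>\<^bsub>?R\<^esub> h \<otimes>\<^bsub>?R\<^esub> k) x"
        by (simp add: eq group_ring_simps(3) sum.distrib[symmetric] distrib_right if_distrib
              cong: if_cong)
    qed
  qed
qed

lemma vec_group_ring_cring:
  "cring (vec_group_ring TYPE('r::comm_ring_1) TYPE('k::ab_group_add) n)"
  by (rule group_ring_cring[OF comm_group_vec])

end

theory Submission
  imports Defs "Jordan_Normal_Form.Determinant" "Berlekamp_Zassenhaus.Berlekamp_Type_Based"
begin

text \<open>
  Write \<open>\<chi>\<close> for a nontrivial additive character of the prime field. The product over \<open>\<int>\<close> attached to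
  \<open>M\<close> has Fourier transform \<open>x \<mapsto> \<Prod>(1 - \<chi> x\<^sub>i) \<Prod>(1 - \<chi> (M x)\<^sub>i)\<close>, so it vanishes exactly when \<open>M\<close>
  is a counterexample to the conclusion.

  From a counterexample one obtains, by adding rows to each other, a counterexample \<open>M\<close> which
  fails only barely: some \<open>x\<close> is nowhere zero and \<open>M x\<close> is zero only at a single row \<open>r\<close>. Let \<open>Q\<close> be
  the product with the factor of row \<open>r\<close> removed. Its Fourier transform is nonzero but is
  supported on the \<open>x\<close> with \<open>(M x)\<^sub>r = 0\<close>, i.e. \<open>Q\<close> is invariant under translation by row \<open>r\<close>.
  Glue two copies of the space along row \<open>r\<close>; dually, consider the pairs \<open>(x, x')\<close> with
  \<open>(M x)\<^sub>r = (M x')\<^sub>r\<close>, a space of dimension \<open>2n - 1\<close>. The \<open>4n - 2\<close> vectors occurring in the two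
  copies of \<open>Q\<close> split into two bases of the glued space, so their product comes from a nonsingular
  matrix. Translation invariance makes each coefficient of this product \<open>p\<close> times a product of two
  coefficients of \<open>Q\<close>: it vanishes modulo \<open>p\<close> but not over \<open>\<int>\<close>.
\<close>

section \<open>An additive character of the prime field\<close>

definition add_char :: "'p::prime_card mod_ring \<Rightarrow> complex" where
  "add_char a = cis (2 * pi * real_of_int (to_int_mod_ring a) / real CARD('p))"

text \<open>The two angles differ by the integer quotient times 2 pi. This absorbs the reduction mod
  p that occurs when representatives are added.\<close>

lemma cis_of_int_mod:
  fixes k :: int and N :: nat
  assumes "N > 0"
  shows "cis (2 * pi * of_int (k mod int N) / real N) = cis (2 * pi * of_int k / real N)"
proof -
  have "2 * pi * of_int k / real N =
        2 * pi * of_int (k mod int N) / real N + 2 * pi * of_int (k div int N)"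
  proof -
    have "real_of_int k = of_int (k div int N) * real N + of_int (k mod int N)"
      by (metis div_mult_mod_eq of_int_add of_int_mult of_int_of_nat_eq)
    then show ?thesis using assms by (simp add: field_simps)
  qed
  then show ?thesis
    by (metis cis_mult cis_multiple_2pi Ints_of_int mult.right_neutral)
qed

lemma add_char_add: "add_char (a + b) = add_char a * add_char b"
proof -
  have "add_char (a + b) = cis (2 * pi * of_int (to_int_mod_ring a + to_int_mod_ring b) / real CARD('a))"
    unfolding add_char_def to_int_mod_ring_add by (rule cis_of_int_mod) simp
  then show ?thesis
    by (simp add: add_char_def cis_mult algebra_simps add_divide_distrib)
qed

lemma add_char_minus_add: "add_char (- (a + b)) = add_char (- a) * add_char (- b)"
  unfolding minus_add_distrib by (rule add_char_add)

lemma add_char_0 [simp]: "add_char 0 = 1"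
  by (simp add: add_char_def)

text \<open>The value 1 forces the representative to be a multiple of p, and representatives lie in
  [0, p). Hence a factor \<open>1 - add_char a\<close> detects exactly whether \<open>a\<close> is
  nonzero.\<close>

lemma add_char_eq_1_iff: "add_char a = 1 \<longleftrightarrow> a = 0"
proof
  assume "add_char (a :: 'a mod_ring) = 1"
  define t where "t = to_int_mod_ring a"
  have t: "0 \<le> t" "t < int CARD('a)"
    using range_to_int_mod_ring[where 'a='a] unfolding t_def by fastforce+
  from \<open>add_char a = 1\<close> have "cos (2 * pi * of_int t / real CARD('a)) = 1"
    unfolding add_char_def t_def by (metis cis.sel(1) one_complex.sel(1))
  then obtain n :: int where "2 * pi * of_int t / real CARD('a) = of_int n * 2 * pi"
    using cos_one_2pi_int by auto
  then have "real_of_int t = of_int n * real CARD('a)"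
    by (simp add: field_simps)
  then have tn: "t = n * int CARD('a)"
    by (metis of_int_eq_iff of_int_mult of_int_of_nat_eq)
  have "t = 0"
    using t tn by (metis mod_mult_self2_is_0 mod_pos_pos_trivial)
  then show "a = 0"
    unfolding t_def using to_int_mod_ring_hom.hom_0_iff by blast
qed simp

section \<open>The Fourier transform on the group ring\<close>

text \<open>Since \<open>'k\<close> is finite, the whole space can replace the two supports as the
  range of summation, which makes the sums easy to interchange.\<close>

lemma group_ring_vec_mult_eq:
  fixes f h :: "'k::{finite, ab_group_add} vec \<Rightarrow> 'r::comm_ring_1"
  assumes "f \<in> carrier (vec_group_ring TYPE('r) TYPE('k) n)"
    and "h \<in> carrier (vec_group_ring TYPE('r) TYPE('k) n)"
  shows "(f \<otimes>\<^bsub>vec_group_ring TYPE('r) TYPE('k) n\<^esub> h) w =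
           (\<Sum>u\<in>carrier_vec n. \<Sum>v\<in>carrier_vec n. if u + v = w then f u * h v else 0)"
  using assms
  by (subst group_ring_mult_eq[of "carrier_vec n" "carrier_vec n"])
     (auto simp: group_ring_carrier_iff monoid_vec_def)

lemma group_ring_minus_eq:
  fixes f h :: "'g \<Rightarrow> 'r::comm_ring_1"
  assumes "comm_group G"
    and "f \<in> carrier (group_ring TYPE('r) G)" "h \<in> carrier (group_ring TYPE('r) G)"
  shows "f \<ominus>\<^bsub>group_ring TYPE('r) G\<^esub> h = (\<lambda>x. f x - h x)"
proof -
  interpret R: cring "group_ring TYPE('r) G" by (rule group_ring_cring[OF assms(1)])
  have "(\<lambda>x. - h x) \<in> carrier (group_ring TYPE('r) G)"
    using assms by (auto simp: group_ring_carrier_iff)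
  then have "\<ominus>\<^bsub>group_ring TYPE('r) G\<^esub> h = (\<lambda>x. - h x)"
    using assms by (intro R.minus_equality) (auto simp: group_ring_simps)
  then show ?thesis
    by (simp add: a_minus_def group_ring_simps)
qed

text \<open>The dual group is identified with the space itself through the scalar product. No
  normalisation is built in, so inversion carries a factor p^n; comparing such factors is what later
  produces the divisibility by p.\<close>

definition fourier :: "nat \<Rightarrow> ('p::prime_card mod_ring vec \<Rightarrow> int) \<Rightarrow> 'p mod_ring vec \<Rightarrow> complex" where
  "fourier n f x = (\<Sum>w\<in>carrier_vec n. of_int (f w) * add_char (x \<bullet> w))"

text \<open>With the sum over \<open>w\<close> moved innermost only \<open>w = u + v\<close>
  survives, and the character splits over that sum.\<close>

lemma fourier_mult:
  fixes f h :: "'p::prime_card mod_ring vec \<Rightarrow> int" and n :: nat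
  defines "R \<equiv> vec_group_ring TYPE(int) TYPE('p mod_ring) n"
  assumes f: "f \<in> carrier R" and h: "h \<in> carrier R" and x: "x \<in> carrier_vec n"
  shows "fourier n (f \<otimes>\<^bsub>R\<^esub> h) x = fourier n f x * fourier n h x"
proof -
  let ?V = "carrier_vec n :: 'p mod_ring vec set"
  have "fourier n (f \<otimes>\<^bsub>R\<^esub> h) x =
      (\<Sum>w\<in>?V. \<Sum>u\<in>?V. \<Sum>v\<in>?V. if u + v = w then of_int (f u * h v) * add_char (x \<bullet> w) else 0)"
    using f h unfolding fourier_def R_def
    by (simp add: group_ring_vec_mult_eq sum_distrib_right of_int_sum if_distrib if_distribR cong: if_cong)
  also have "\<dots> = (\<Sum>u\<in>?V. \<Sum>v\<in>?V. \<Sum>w\<in>?V. if u + v = w then of_int (f u * h v) * add_char (x \<bullet> w) else 0)"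
    by (subst sum.swap, subst (2) sum.swap) simp
  also have "\<dots> = (\<Sum>u\<in>?V. \<Sum>v\<in>?V. of_int (f u * h v) * add_char (x \<bullet> (u + v)))"
    by (intro sum.cong refl, subst sum.delta') auto
  also have "\<dots> = (\<Sum>u\<in>?V. \<Sum>v\<in>?V. (of_int (f u) * add_char (x \<bullet> u)) * (of_int (h v) * add_char (x \<bullet> v)))"
    using x by (intro sum.cong refl) (simp add: scalar_prod_add_distrib[of _ n] add_char_add mult_ac)
  also have "\<dots> = fourier n f x * fourier n h x"
    unfolding fourier_def by (simp add: sum_product)
  finally show ?thesis .
qed

lemma fourier_group_elem:
  assumes "v \<in> carrier_vec n"
  shows "fourier n (group_elem v) x = add_char (x \<bullet> v)"
proof -
  have "fourier n (group_elem v) x = (\<Sum>w\<in>carrier_vec n. if w = v then add_char (x \<bullet> w) else 0)"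
    unfolding fourier_def group_elem_def by (intro sum.cong) auto
  also have "\<dots> = add_char (x \<bullet> v)"
    using assms by (subst sum.delta) auto
  finally show ?thesis .
qed

lemma one_minus_group_elem_closed:
  fixes v :: "'k::{finite, ab_group_add} vec" and n :: nat
  defines "R \<equiv> vec_group_ring TYPE('r::comm_ring_1) TYPE('k) n"
  assumes "v \<in> carrier_vec n"
  shows "\<one>\<^bsub>R\<^esub> \<ominus>\<^bsub>R\<^esub> group_elem v \<in> carrier R"
proof -
  interpret R: cring R unfolding R_def by (rule vec_group_ring_cring)
  show ?thesis
    using assms by (intro R.minus_closed R.one_closed)
      (auto simp: R_def monoid_vec_def intro!: group_elem_closed)
qed

lemma one_minus_group_elem_eq:
  fixes v :: "'k::{finite, ab_group_add} vec" and n :: nat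
  defines "R \<equiv> vec_group_ring TYPE('r::comm_ring_1) TYPE('k) n"
  assumes "v \<in> carrier_vec n"
  shows "\<one>\<^bsub>R\<^esub> \<ominus>\<^bsub>R\<^esub> group_elem v = (\<lambda>w. group_elem (0\<^sub>v n) w - group_elem v w)"
proof -
  have 1: "group_elem (0\<^sub>v n) \<in> carrier R" "group_elem v \<in> carrier R"
    using assms by (auto simp: R_def monoid_vec_def intro!: group_elem_closed)
  have "\<one>\<^bsub>R\<^esub> = group_elem (0\<^sub>v n)"
    by (simp add: R_def group_ring_simps monoid_vec_def)
  with 1 show ?thesis
    unfolding R_def by (simp add: group_ring_minus_eq comm_group_vec)
qed

text \<open>The one of the ring is the group element of the zero vector, so each factor transforms
  to \<open>1 - add_char (x \<bullet> u i)\<close>; multiplicativity and induction on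
  \<open>I\<close> do the rest.\<close>

lemma fourier_finprod:
  fixes u :: "'i \<Rightarrow> 'p::prime_card mod_ring vec" and n :: nat
  defines "R \<equiv> vec_group_ring TYPE(int) TYPE('p mod_ring) n"
  assumes "finite I" and u: "\<And>i. i \<in> I \<Longrightarrow> u i \<in> carrier_vec n" and x: "x \<in> carrier_vec n"
  shows "fourier n (\<Otimes>\<^bsub>R\<^esub>i\<in>I. \<one>\<^bsub>R\<^esub> \<ominus>\<^bsub>R\<^esub> group_elem (u i)) x = (\<Prod>i\<in>I. 1 - add_char (x \<bullet> u i))"
proof -
  interpret R: cring R unfolding R_def by (rule vec_group_ring_cring)
  have cl: "\<one>\<^bsub>R\<^esub> \<ominus>\<^bsub>R\<^esub> group_elem v \<in> carrier R" if "v \<in> carrier_vec n" for v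
    using that unfolding R_def by (rule one_minus_group_elem_closed)
  have one: "fourier n (\<one>\<^bsub>R\<^esub> \<ominus>\<^bsub>R\<^esub> group_elem v) x = 1 - add_char (x \<bullet> v)"
    if v: "v \<in> carrier_vec n" for v
  proof -
    have "fourier n (\<one>\<^bsub>R\<^esub> \<ominus>\<^bsub>R\<^esub> group_elem v) x =
        fourier n (group_elem (0\<^sub>v n)) x - fourier n (group_elem v) x"
      using v by (simp add: R_def one_minus_group_elem_eq fourier_def algebra_simps sum_subtractf)
    then show ?thesis using v x by (simp add: fourier_group_elem)
  qed
  show ?thesis
    using \<open>finite I\<close> u
  proof (induction I)
    case empty
    have "\<one>\<^bsub>R\<^esub> = group_elem (0\<^sub>v n)"
      by (simp add: R_def group_ring_simps monoid_vec_def)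
    then show ?case using x by (simp add: fourier_group_elem)
  next
    case (insert j I)
    have "(\<Otimes>\<^bsub>R\<^esub>i\<in>insert j I. \<one>\<^bsub>R\<^esub> \<ominus>\<^bsub>R\<^esub> group_elem (u i)) =
        (\<one>\<^bsub>R\<^esub> \<ominus>\<^bsub>R\<^esub> group_elem (u j)) \<otimes>\<^bsub>R\<^esub> (\<Otimes>\<^bsub>R\<^esub>i\<in>I. \<one>\<^bsub>R\<^esub> \<ominus>\<^bsub>R\<^esub> group_elem (u i))"
      using insert cl by (intro R.finprod_insert) auto
    moreover have c: "(\<Otimes>\<^bsub>R\<^esub>i\<in>I. \<one>\<^bsub>R\<^esub> \<ominus>\<^bsub>R\<^esub> group_elem (u i)) \<in> carrier R"
      using insert cl by (intro R.finprod_closed) auto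
    moreover have "\<one>\<^bsub>R\<^esub> \<ominus>\<^bsub>R\<^esub> group_elem (u j) \<in> carrier R"
      using insert cl by auto
    note fourier_mult[OF this[unfolded R_def] c[unfolded R_def] x, folded R_def]
    ultimately show ?case
      using insert by (simp add: one)
  qed
qed

section \<open>Change of coefficients and the transform of the product\<close>

text \<open>Applying \<open>of_int\<close> to every coefficient can only shrink the support, and it
  commutes with the finite sums of a convolution.\<close>

lemma of_int_mult_group_ring:
  fixes f h :: "'k::{finite, ab_group_add} vec \<Rightarrow> int" and n :: nat
  defines "Z \<equiv> vec_group_ring TYPE(int) TYPE('k) n"
    and "R \<equiv> vec_group_ring TYPE('r::comm_ring_1) TYPE('k) n"
  assumes f: "f \<in> carrier Z" and h: "h \<in> carrier Z"
  shows "(\<lambda>w. of_int (f w)) \<in> carrier R"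
    and "(\<lambda>w. of_int ((f \<otimes>\<^bsub>Z\<^esub> h) w)) = (\<lambda>w. of_int (f w)) \<otimes>\<^bsub>R\<^esub> (\<lambda>w. of_int (h w))"
proof -
  have *: "(\<lambda>w. of_int (f w)) \<in> carrier R" if "f \<in> carrier Z" for f
  proof -
    have "{w. (of_int (f w) :: 'r) \<noteq> 0} \<subseteq> {w. f w \<noteq> 0}" by auto
    then show ?thesis using that unfolding Z_def R_def group_ring_carrier_iff
      by (meson finite_subset order_trans)
  qed
  show "(\<lambda>w. of_int (f w)) \<in> carrier R" by (rule *) fact
  show "(\<lambda>w. of_int ((f \<otimes>\<^bsub>Z\<^esub> h) w)) = (\<lambda>w. of_int (f w)) \<otimes>\<^bsub>R\<^esub> (\<lambda>w. of_int (h w))"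
    using f h *[OF f] *[OF h] unfolding Z_def R_def
    by (auto simp: fun_eq_iff group_ring_vec_mult_eq of_int_sum if_distrib intro!: sum.cong cong: if_cong)
qed

lemma of_int_finprod_group_ring:
  fixes u :: "'i \<Rightarrow> 'k::{finite, ab_group_add} vec" and n :: nat
  defines "Z \<equiv> vec_group_ring TYPE(int) TYPE('k) n"
    and "R \<equiv> vec_group_ring TYPE('r::comm_ring_1) TYPE('k) n"
  assumes "finite I" and u: "\<And>i. i \<in> I \<Longrightarrow> u i \<in> carrier_vec n"
  shows "(\<lambda>w. of_int ((\<Otimes>\<^bsub>Z\<^esub>i\<in>I. \<one>\<^bsub>Z\<^esub> \<ominus>\<^bsub>Z\<^esub> group_elem (u i)) w)) =
           (\<Otimes>\<^bsub>R\<^esub>i\<in>I. \<one>\<^bsub>R\<^esub> \<ominus>\<^bsub>R\<^esub> group_elem (u i))"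
proof -
  interpret Z: cring Z unfolding Z_def by (rule vec_group_ring_cring)
  interpret R: cring R unfolding R_def by (rule vec_group_ring_cring)
  have cl: "\<one>\<^bsub>Z\<^esub> \<ominus>\<^bsub>Z\<^esub> group_elem v \<in> carrier Z" "\<one>\<^bsub>R\<^esub> \<ominus>\<^bsub>R\<^esub> group_elem v \<in> carrier R"
    if "v \<in> carrier_vec n" for v
    using that unfolding Z_def R_def by (rule one_minus_group_elem_closed)+
  have one: "(\<lambda>w. of_int ((\<one>\<^bsub>Z\<^esub> \<ominus>\<^bsub>Z\<^esub> group_elem v) w)) = \<one>\<^bsub>R\<^esub> \<ominus>\<^bsub>R\<^esub> group_elem v"
    if "v \<in> carrier_vec n" for v
    using that unfolding Z_def R_def one_minus_group_elem_eq[OF that]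
    by (auto simp: group_elem_def fun_eq_iff)
  show ?thesis
    using \<open>finite I\<close> u
  proof (induction I)
    case empty
    show ?case
      unfolding Z.finprod_empty R.finprod_empty unfolding Z_def R_def
      by (auto simp: group_ring_simps group_elem_def fun_eq_iff)
  next
    case (insert j I)
    have c: "(\<lambda>i. \<one>\<^bsub>Z\<^esub> \<ominus>\<^bsub>Z\<^esub> group_elem (u i)) \<in> I \<rightarrow> carrier Z"
        "(\<lambda>i. \<one>\<^bsub>R\<^esub> \<ominus>\<^bsub>R\<^esub> group_elem (u i)) \<in> I \<rightarrow> carrier R"
      using insert cl by auto
    then have "(\<Otimes>\<^bsub>Z\<^esub>i\<in>I. \<one>\<^bsub>Z\<^esub> \<ominus>\<^bsub>Z\<^esub> group_elem (u i)) \<in> carrier Z"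
      by (intro Z.finprod_closed) auto
    then show ?case
      using insert c cl[of "u j"] of_int_mult_group_ring(2)[where 'r='r and 'k='k and n=n, folded Z_def R_def] one[of "u j"]
      by (simp add: Z.finprod_insert R.finprod_insert)
  qed
qed

lemma finprod_one_minus_group_elem_closed:
  fixes u :: "'i \<Rightarrow> 'k::{finite, ab_group_add} vec" and n :: nat
  defines "R \<equiv> vec_group_ring TYPE('r::comm_ring_1) TYPE('k) n"
  assumes "\<And>i. i \<in> I \<Longrightarrow> u i \<in> carrier_vec n"
  shows "(\<Otimes>\<^bsub>R\<^esub>i\<in>I. \<one>\<^bsub>R\<^esub> \<ominus>\<^bsub>R\<^esub> group_elem (u i)) \<in> carrier R"
proof -
  interpret R: cring R unfolding R_def by (rule vec_group_ring_cring)
  show ?thesis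
    using assms by (intro R.finprod_closed) (auto simp: R_def intro!: one_minus_group_elem_closed)
qed

lemma basis_row_product_closed:
  fixes M :: "'p::prime_card mod_ring mat"
  assumes M: "M \<in> carrier_mat n n"
  shows "basis_row_product TYPE('r::comm_ring_1) n M \<in> carrier (vec_group_ring TYPE('r) TYPE('p mod_ring) n)"
proof -
  interpret R: cring "vec_group_ring TYPE('r) TYPE('p mod_ring) n" by (rule vec_group_ring_cring)
  show ?thesis
    unfolding basis_row_product_def Let_def
    using M by (intro R.m_closed finprod_one_minus_group_elem_closed) auto
qed

text \<open>Turns vanishing over F_p into divisibility by p of the coefficients over the
  integers.\<close>

lemma basis_row_product_of_int:
  fixes M :: "'p::prime_card mod_ring mat"
  assumes M: "M \<in> carrier_mat n n"
  shows "basis_row_product TYPE('r::comm_ring_1) n M = (\<lambda>w. of_int (basis_row_product TYPE(int) n M w))"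
proof -
  have rows: "\<And>i. i \<in> {..<n} \<Longrightarrow> row M i \<in> carrier_vec n"
    and units: "\<And>i. i \<in> {..<n} \<Longrightarrow> (unit_vec n i :: 'p mod_ring vec) \<in> carrier_vec n"
    using M by auto
  show ?thesis
    unfolding basis_row_product_def Let_def
    by (simp only: of_int_finprod_group_ring[OF finite_lessThan rows] of_int_finprod_group_ring[OF finite_lessThan units]
        of_int_mult_group_ring(2)[OF finprod_one_minus_group_elem_closed[OF units] finprod_one_minus_group_elem_closed[OF rows]])
qed

text \<open>Arbitrary index sets cover both the full product of a matrix and the one with the factor
  of a single row removed.\<close>

lemma fourier_mult_finprod:
  fixes u :: "'i \<Rightarrow> 'p::prime_card mod_ring vec" and v :: "'j \<Rightarrow> 'p mod_ring vec" and n :: nat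
  defines "R \<equiv> vec_group_ring TYPE(int) TYPE('p mod_ring) n"
  assumes "finite I" "\<And>i. i \<in> I \<Longrightarrow> u i \<in> carrier_vec n"
    and "finite J" "\<And>j. j \<in> J \<Longrightarrow> v j \<in> carrier_vec n" and "x \<in> carrier_vec n"
  shows "fourier n ((\<Otimes>\<^bsub>R\<^esub>i\<in>I. \<one>\<^bsub>R\<^esub> \<ominus>\<^bsub>R\<^esub> group_elem (u i)) \<otimes>\<^bsub>R\<^esub>
             (\<Otimes>\<^bsub>R\<^esub>j\<in>J. \<one>\<^bsub>R\<^esub> \<ominus>\<^bsub>R\<^esub> group_elem (v j))) x =
           (\<Prod>i\<in>I. 1 - add_char (x \<bullet> u i)) * (\<Prod>j\<in>J. 1 - add_char (x \<bullet> v j))"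
proof -
  note closed = finprod_one_minus_group_elem_closed[where 'r = int, OF assms(3)]
    finprod_one_minus_group_elem_closed[where 'r = int, OF assms(5)]
  show ?thesis
    unfolding R_def by (simp only: fourier_mult[OF closed assms(6)] fourier_finprod[OF assms(2,3,6)]
        fourier_finprod[OF assms(4,5,6)])
qed

lemma fourier_basis_row_product:
  fixes M :: "'p::prime_card mod_ring mat"
  assumes M: "M \<in> carrier_mat n n" and x: "x \<in> carrier_vec n"
  shows "fourier n (basis_row_product TYPE(int) n M) x =
           (\<Prod>i<n. 1 - add_char (x $ i)) * (\<Prod>i<n. 1 - add_char ((M *\<^sub>v x) $ i))"
proof -
  have "fourier n (basis_row_product TYPE(int) n M) x =
      (\<Prod>i<n. 1 - add_char (x \<bullet> unit_vec n i)) * (\<Prod>i<n. 1 - add_char (x \<bullet> row M i))"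
    unfolding basis_row_product_def Let_def using M x by (intro fourier_mult_finprod) auto
  also have "\<dots> = (\<Prod>i<n. 1 - add_char (x $ i)) * (\<Prod>i<n. 1 - add_char ((M *\<^sub>v x) $ i))"
    using M x by (intro arg_cong2[of _ _ _ _ "(*)"] prod.cong refl)
      (auto simp: comm_scalar_prod[of x n])
  finally show ?thesis .
qed

section \<open>Orthogonality and Fourier inversion\<close>

text \<open>If \<open>w $ k\<close> is nonzero, translating \<open>x\<close> by the unit vector at
  \<open>k\<close> permutes the space and multiplies the sum by \<open>add_char (w $ k)\<close>,
  which is not 1; so the sum is 0.\<close>

lemma sum_add_char_scalar_prod:
  fixes w :: "'p::prime_card mod_ring vec"
  assumes w: "w \<in> carrier_vec n"
  shows "(\<Sum>x\<in>carrier_vec n. add_char (x \<bullet> w)) = (if w = 0\<^sub>v n then of_nat CARD('p) ^ n else 0)"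
proof (cases "w = 0\<^sub>v n")
  case True
  then have "(\<Sum>x\<in>carrier_vec n. add_char (x \<bullet> w)) = (\<Sum>x\<in>(carrier_vec n :: 'p mod_ring vec set). 1)"
    by (intro sum.cong) auto
  then show ?thesis using True by (simp add: card_carrier_vec)
next
  case False
  then obtain k where k: "k < n" "w $ k \<noteq> 0"
    using w by (metis carrier_vecD eq_vecI index_zero_vec(1) index_zero_vec(2))
  let ?S = "\<Sum>x\<in>carrier_vec n. add_char (x \<bullet> w)"
  have shift: "x - unit_vec n k + unit_vec n k = x" "x + unit_vec n k - unit_vec n k = x"
    if "x \<in> carrier_vec n" for x :: "'p mod_ring vec"
    using that by auto
  have "?S = (\<Sum>x\<in>carrier_vec n. add_char ((x + unit_vec n k) \<bullet> w))"
    using w by (intro sum.reindex_bij_witness[of _ "\<lambda>x. x + unit_vec n k" "\<lambda>x. x - unit_vec n k"])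
      (auto simp: shift)
  also have "\<dots> = (\<Sum>x\<in>carrier_vec n. add_char (w $ k) * add_char (x \<bullet> w))"
    using w k by (intro sum.cong refl)
      (simp add: add_scalar_prod_distrib[of _ n] add_char_add scalar_prod_left_unit)
  also have "\<dots> = add_char (w $ k) * ?S"
    by (simp add: sum_distrib_left)
  finally have "(1 - add_char (w $ k)) * ?S = 0" by (simp add: algebra_simps)
  then show ?thesis using False k by (auto simp: add_char_eq_1_iff)
qed

text \<open>After the sums are swapped, orthogonality of characters kills every term except
  \<open>w = y\<close>.\<close>

lemma fourier_inversion:
  fixes f :: "'p::prime_card mod_ring vec \<Rightarrow> int"
  assumes y: "y \<in> carrier_vec n"
  shows "(\<Sum>x\<in>carrier_vec n. add_char (- (x \<bullet> y)) * fourier n f x) = of_nat CARD('p) ^ n * of_int (f y)"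
proof -
  let ?V = "carrier_vec n :: 'p mod_ring vec set"
  have "(\<Sum>x\<in>?V. add_char (- (x \<bullet> y)) * fourier n f x) =
      (\<Sum>x\<in>?V. \<Sum>w\<in>?V. of_int (f w) * add_char (x \<bullet> (w - y)))"
    using y unfolding fourier_def sum_distrib_left
    by (intro sum.cong refl)
      (simp add: scalar_prod_minus_distrib[of _ n] add_char_add mult_ac flip: add_uminus_conv_diff)
  also have "\<dots> = (\<Sum>w\<in>?V. of_int (f w) * (\<Sum>x\<in>?V. add_char (x \<bullet> (w - y))))"
    by (subst sum.swap) (simp add: sum_distrib_left)
  also have "\<dots> = (\<Sum>w\<in>?V. if w = y then of_nat CARD('p) ^ n * of_int (f w) else 0)"
  proof (intro sum.cong refl)
    fix w :: "'p mod_ring vec" assume w: "w \<in> ?V"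
    have "w - y = 0\<^sub>v n \<longleftrightarrow> w = y"
      using w y by (auto simp: vec_eq_iff)
    then show "of_int (f w) * (\<Sum>x\<in>?V. add_char (x \<bullet> (w - y))) =
        (if w = y then of_nat CARD('p) ^ n * of_int (f w) else 0)"
      using w y by (subst sum_add_char_scalar_prod) auto
  qed
  also have "\<dots> = of_nat CARD('p) ^ n * of_int (f y)"
    using y by simp
  finally show ?thesis .
qed

section \<open>Reduction to a critical counterexample\<close>

lemma invertible_mat_obtain_inverse:
  assumes M: "M \<in> carrier_mat n n" and "invertible_mat M"
  obtains B where "B \<in> carrier_mat n n" "B * M = 1\<^sub>m n" "M * B = 1\<^sub>m n"
proof -
  from \<open>invertible_mat M\<close> obtain B where "inverts_mat M B" "inverts_mat B M"
    by (auto simp: invertible_mat_def)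
  then have MB: "M * B = 1\<^sub>m n" and BM: "B * M = 1\<^sub>m (dim_row B)"
    using M by (auto simp: inverts_mat_def)
  then have "dim_col B = n" "dim_row B = n"
    using M by (metis carrier_matD(2) index_mult_mat(3) index_one_mat(3))+
  then show thesis using that[of B] MB BM by auto
qed

lemma invertible_mat_iff_kernel:
  fixes M :: "'k::field mat"
  assumes M: "M \<in> carrier_mat n n"
  shows "invertible_mat M \<longleftrightarrow> (\<forall>x\<in>carrier_vec n. M *\<^sub>v x = 0\<^sub>v n \<longrightarrow> x = 0\<^sub>v n)"
proof
  assume "invertible_mat M"
  then obtain B where B: "B \<in> carrier_mat n n" and BM: "B * M = 1\<^sub>m n"
    by (rule invertible_mat_obtain_inverse[OF M])
  show "\<forall>x\<in>carrier_vec n. M *\<^sub>v x = 0\<^sub>v n \<longrightarrow> x = 0\<^sub>v n"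
  proof (intro ballI impI)
    fix x :: "'k vec" assume x: "x \<in> carrier_vec n" and 0: "M *\<^sub>v x = 0\<^sub>v n"
    have "x = (B * M) *\<^sub>v x" using x BM by simp
    also have "\<dots> = B *\<^sub>v (M *\<^sub>v x)"
      using B M x by (rule assoc_mult_mat_vec)
    also have "\<dots> = 0\<^sub>v n" using 0 B by auto
    finally show "x = 0\<^sub>v n" .
  qed
next
  assume "\<forall>x\<in>carrier_vec n. M *\<^sub>v x = 0\<^sub>v n \<longrightarrow> x = 0\<^sub>v n"
  then have "det M \<noteq> 0" using det_0_iff_vec_prod_zero[OF M] by auto
  then have "M \<in> Units (ring_mat TYPE('k) n ())" by (rule det_non_zero_imp_unit[OF M])
  then obtain B where "B \<in> carrier_mat n n" "B * M = 1\<^sub>m n" "M * B = 1\<^sub>m n"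
    by (auto simp: Units_def ring_mat_def)
  then show "invertible_mat M"
    using M by (auto simp: invertible_mat_def inverts_mat_def)
qed

lemma addrow_mult_vec_index:
  fixes M :: "'k::field mat"
  assumes "M \<in> carrier_mat n n" "x \<in> carrier_vec n" "k < n" "i < n" "j < n"
  shows "(addrow 1 i j M *\<^sub>v x) $ k = (if k = i then (M *\<^sub>v x) $ j + (M *\<^sub>v x) $ i else (M *\<^sub>v x) $ k)"
  using assms by (auto simp: scalar_prod_def sum.distrib algebra_simps)

text \<open>Among all counterexamples \<open>M\<close> and nowhere zero \<open>x\<close>, take a
  pair with the fewest zeros in \<open>M *\<^sub>v x\<close>. Adding a row with nonzero value to a
  row \<open>i\<close> with value zero removes one zero, so by minimality the new matrix is no
  counterexample. A good vector for it can fail for \<open>M\<close> only at row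
  \<open>i\<close>.\<close>

lemma critical_counterexample:
  fixes M\<^sub>0 :: "'k::field mat"
  assumes "M\<^sub>0 \<in> carrier_mat n n" "invertible_mat M\<^sub>0"
    and "\<forall>x\<in>carrier_vec n. (\<forall>i<n. x $ i \<noteq> 0) \<longrightarrow> (\<exists>i<n. (M\<^sub>0 *\<^sub>v x) $ i = 0)"
  obtains M :: "'k mat" and r x where "M \<in> carrier_mat n n" "invertible_mat M"
    "\<forall>x\<in>carrier_vec n. (\<forall>i<n. x $ i \<noteq> 0) \<longrightarrow> (\<exists>i<n. (M *\<^sub>v x) $ i = 0)"
    "r < n" "x \<in> carrier_vec n" "\<forall>i<n. x $ i \<noteq> 0" "\<forall>i<n. i \<noteq> r \<longrightarrow> (M *\<^sub>v x) $ i \<noteq> 0"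
proof -
  define bad where "bad M \<longleftrightarrow> M \<in> carrier_mat n n \<and> invertible_mat M \<and>
      (\<forall>x\<in>carrier_vec n. (\<forall>i<n. x $ i \<noteq> 0) \<longrightarrow> (\<exists>i<n. (M *\<^sub>v x) $ i = 0))" for M :: "'k mat"
  define Z where "Z M x = {i. i < n \<and> (M *\<^sub>v x) $ i = 0}" for M :: "'k mat" and x
  define ok where "ok x \<longleftrightarrow> x \<in> carrier_vec n \<and> (\<forall>i<n. x $ i \<noteq> 0)" for x :: "'k vec"
  \<comment> \<open>Any nowhere zero vector would do here; it only shows that there is a pair to
    minimise over.\<close>
  have "bad M\<^sub>0" "ok (vec n (\<lambda>_. 1))" using assms by (auto simp: bad_def ok_def)
  then obtain M x where M: "bad M" and x: "ok x"
    and least: "\<And>M' x'. bad M' \<Longrightarrow> ok x' \<Longrightarrow> card (Z M x) \<le> card (Z M' x')"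
    using ex_has_least_nat[of "\<lambda>(M, x). bad M \<and> ok x" "(M\<^sub>0, vec n (\<lambda>_. 1))" "\<lambda>(M, x). card (Z M x)"]
    by auto
  note Mc = M[unfolded bad_def, THEN conjunct1] and xc = x[unfolded ok_def, THEN conjunct1]
  have ker: "\<forall>x\<in>carrier_vec n. M *\<^sub>v x = 0\<^sub>v n \<longrightarrow> x = 0\<^sub>v n"
    using M invertible_mat_iff_kernel[OF Mc] by (simp add: bad_def)
  obtain i where i: "i < n" "(M *\<^sub>v x) $ i = 0"
    using M x by (auto simp: bad_def ok_def)
  \<comment> \<open>The zero row \<open>i\<close> shows that the dimension is positive, so a nowhere
    zero \<open>x\<close> is not the zero vector. Invertibility then supplies a row \<open>j\<close>
    with nonzero value.\<close>
  have "x \<noteq> 0\<^sub>v n" using x i(1) by (auto simp: ok_def)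
  then have "M *\<^sub>v x \<noteq> 0\<^sub>v n" using ker xc by blast
  then obtain j where j: "j < n" "(M *\<^sub>v x) $ j \<noteq> 0"
    using Mc by (metis carrier_matD(1) dim_mult_mat_vec eq_vecI index_zero_vec(1) index_zero_vec(2))
  define M' where "M' = addrow 1 i j M"
  have M'c: "M' \<in> carrier_mat n n" using Mc by (simp add: M'_def)
  have M'x: "(M' *\<^sub>v y) $ k = (if k = i then (M *\<^sub>v y) $ j + (M *\<^sub>v y) $ i else (M *\<^sub>v y) $ k)"
    if "y \<in> carrier_vec n" "k < n" for y k
    unfolding M'_def using Mc that i(1) j(1) by (intro addrow_mult_vec_index) auto
  have "invertible_mat M'"
    unfolding invertible_mat_iff_kernel[OF M'c]
  proof (intro ballI impI)
    fix y :: "'k vec" assume y: "y \<in> carrier_vec n" and 0: "M' *\<^sub>v y = 0\<^sub>v n"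
    have *: "(M' *\<^sub>v y) $ k = 0" if "k < n" for k using 0 that by simp
    have "(M *\<^sub>v y) $ k = 0" if "k < n" for k
      using *[OF that] *[OF j(1)] M'x[OF y that] M'x[OF y j(1)] i j by (auto split: if_splits)
    then have "M *\<^sub>v y = 0\<^sub>v n" using Mc by (intro eq_vecI) auto
    then show "y = 0\<^sub>v n" using ker y by blast
  qed
  have "Z M' x = Z M x - {i}"
    unfolding Z_def using i j M'x[OF xc] by (auto split: if_splits)
  moreover have "i \<in> Z M x" "finite (Z M x)" using i by (auto simp: Z_def)
  ultimately have "card (Z M' x) < card (Z M x)" by (metis card_Diff1_less)
  then have "\<not> bad M'" using least[OF _ x] by (metis not_less)
  then obtain y where y: "ok y" "\<And>k. k < n \<Longrightarrow> (M' *\<^sub>v y) $ k \<noteq> 0"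
    using M'c \<open>invertible_mat M'\<close> by (auto simp: bad_def ok_def)
  \<comment> \<open>The vector returned is \<open>y\<close>, not the minimising \<open>x\<close>:
    the matrices \<open>M\<close> and \<open>M'\<close> agree on all rows except
    \<open>i\<close>.\<close>
  show thesis
  proof (rule that[of M i y])
    show "\<forall>k<n. k \<noteq> i \<longrightarrow> (M *\<^sub>v y) $ k \<noteq> 0"
      using y(2) M'x[OF y(1)[unfolded ok_def, THEN conjunct1]] by metis
  qed (use M y i in \<open>auto simp: bad_def ok_def\<close>)
qed

section \<open>Gluing two copies of the space along a row\<close>

lemma sum_lessThan_add: "(\<Sum>k<n + m. f k) = (\<Sum>k<n. f k) + (\<Sum>k<m. f (n + k))"
  for f :: "nat \<Rightarrow> 'a::comm_monoid_add"
  by (induction m) (simp_all add: add.assoc)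

lemma prod_lessThan_add: "(\<Prod>k<n + m. f k) = (\<Prod>k<n. f k) * (\<Prod>k<m. f (n + k))"
  for f :: "nat \<Rightarrow> 'a::comm_monoid_mult"
  by (induction m) (simp_all add: mult.assoc)

text \<open>The index \<open>m\<close>, absent on the left, is the one sent to \<open>j\<close>. The
  transposition is its own inverse, and it is the identity when \<open>j = m\<close>.\<close>

lemma bij_betw_transpose_lessThan:
  assumes "j < Suc m"
  shows "bij_betw (transpose j m) {..<m} ({..<Suc m} - {j})"
  using assms
  by (intro bij_betwI[where g = "transpose j m"]) (auto simp: transpose_def)

text \<open>
  A vector of length \<open>2n - 1\<close> (with \<open>n = Suc m\<close>) encodes the pair \<open>(x, x')\<close> by dropping the entry
  \<open>x'\<^sub>j\<close>, which \<open>(M x)\<^sub>r = (M x')\<^sub>r\<close> determines when \<open>M\<^sub>r\<^sub>j \<noteq> 0\<close>; the transposition of \<open>j\<close> and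
  \<open>m\<close> enumerates the indices other than \<open>j\<close>. The rows of \<open>glue_mat\<close> evaluate to \<open>(M x)\<^sub>i\<close> for
  \<open>i \<noteq> r\<close>, to \<open>x'\<^sub>j\<close> (at position \<open>r\<close>), and to \<open>(M x')\<^sub>i\<close> for \<open>i \<noteq> r\<close>.
\<close>

definition glue_vec :: "nat \<Rightarrow> nat \<Rightarrow> 'k vec \<Rightarrow> 'k vec \<Rightarrow> 'k vec" where
  "glue_vec m j x x' =
     vec (Suc m + m) (\<lambda>k. if k < Suc m then x $ k else x' $ transpose j m (k - Suc m))"

definition glue_mat :: "nat \<Rightarrow> nat \<Rightarrow> nat \<Rightarrow> 'k::field mat \<Rightarrow> 'k mat" where
  "glue_mat m j r M =
     mat (Suc m + m) (Suc m + m) (\<lambda>(i, k).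
       if i < Suc m \<and> i \<noteq> r then (if k < Suc m then M $$ (i, k) else 0)
       else
         let a = (\<lambda>l. if i = r then (if l = j then 1 else 0) else M $$ (transpose r m (i - Suc m), l))
         in if k < Suc m then a j * M $$ (r, k) / M $$ (r, j)
            else a (transpose j m (k - Suc m)) - a j * M $$ (r, transpose j m (k - Suc m)) / M $$ (r, j))"

text \<open>Here \<open>c\<close> is row \<open>r\<close> and \<open>a\<close> is a functional to be
  evaluated at \<open>x'\<close>. The constraint \<open>eq\<close> is solved for
  \<open>x' j\<close>, and substituting this value into the right-hand side gives the coefficients
  used in \<open>glue_mat\<close>.\<close>

lemma sum_glue:
  fixes a c x x' :: "nat \<Rightarrow> 'k::field"
  assumes j: "j < Suc m" and "c j \<noteq> 0"
    and eq: "(\<Sum>k<Suc m. c k * x k) = (\<Sum>k<Suc m. c k * x' k)"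
  shows "(\<Sum>k<Suc m. a j * c k / c j * x k) +
         (\<Sum>k<m. (a (transpose j m k) - a j * c (transpose j m k) / c j) * x' (transpose j m k)) =
         (\<Sum>k<Suc m. a k * x' k)"
proof -
  let ?J = "{..<Suc m} - {j}"
  have split: "(\<Sum>k<Suc m. f k) = f j + (\<Sum>k\<in>?J. f k)" for f :: "nat \<Rightarrow> 'k"
    using j by (intro sum.remove) auto
  have "(\<Sum>k<m. (a (transpose j m k) - a j * c (transpose j m k) / c j) * x' (transpose j m k)) =
      (\<Sum>k\<in>?J. (a k - a j * c k / c j) * x' k)"
    by (rule sum.reindex_bij_betw[OF bij_betw_transpose_lessThan[OF j]])
  also have "\<dots> = (\<Sum>k\<in>?J. a k * x' k) - a j / c j * (\<Sum>k\<in>?J. c k * x' k)"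
    by (simp add: algebra_simps sum_subtractf sum_distrib_left)
  finally have 1: "(\<Sum>k<m. (a (transpose j m k) - a j * c (transpose j m k) / c j) * x' (transpose j m k)) =
      (\<Sum>k\<in>?J. a k * x' k) - a j / c j * (\<Sum>k\<in>?J. c k * x' k)" .
  have "(\<Sum>k<Suc m. a j * c k / c j * x k) = a j / c j * (\<Sum>k<Suc m. c k * x k)"
    by (simp only: sum_distrib_left) (simp add: mult_ac)
  also have "\<dots> = a j / c j * (c j * x' j + (\<Sum>k\<in>?J. c k * x' k))"
    unfolding eq split ..
  finally show ?thesis
    unfolding 1 split[of "\<lambda>k. a k * x' k"] using \<open>c j \<noteq> 0\<close> by (simp add: field_simps)
qed

lemma glue_vec_carrier: "glue_vec m j x x' \<in> carrier_vec (Suc m + m)"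
  by (simp add: glue_vec_def)

lemma glue_mat_carrier: "glue_mat m j r M \<in> carrier_mat (Suc m + m) (Suc m + m)"
  by (simp add: glue_mat_def)

lemma glue_mat_mult_glue_vec:
  fixes M :: "'k::field mat"
  assumes M: "M \<in> carrier_mat (Suc m) (Suc m)" and j: "j < Suc m" and r: "r < Suc m"
    and x: "x \<in> carrier_vec (Suc m)" and x': "x' \<in> carrier_vec (Suc m)"
    and nz: "M $$ (r, j) \<noteq> 0" and eq: "(M *\<^sub>v x) $ r = (M *\<^sub>v x') $ r"
  shows "i < Suc m \<Longrightarrow> (glue_mat m j r M *\<^sub>v glue_vec m j x x') $ i = (if i = r then x' $ j else (M *\<^sub>v x) $ i)"
    and "l < m \<Longrightarrow> (glue_mat m j r M *\<^sub>v glue_vec m j x x') $ (Suc m + l) = (M *\<^sub>v x') $ transpose r m l"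
proof -
  have Mv: "(M *\<^sub>v y) $ i = (\<Sum>k<Suc m. M $$ (i, k) * y $ k)" if "y \<in> carrier_vec (Suc m)" "i < Suc m" for y i
    using that M by (simp add: scalar_prod_def lessThan_atLeast0)
  have G: "(glue_mat m j r M *\<^sub>v glue_vec m j x x') $ i =
      (\<Sum>k<Suc m. glue_mat m j r M $$ (i, k) * x $ k) +
      (\<Sum>k<m. glue_mat m j r M $$ (i, Suc m + k) * x' $ transpose j m k)" if "i < Suc m + m" for i
  proof -
    have "(glue_mat m j r M *\<^sub>v glue_vec m j x x') $ i =
        (\<Sum>k<Suc m + m. glue_mat m j r M $$ (i, k) * glue_vec m j x x' $ k)"
      using that glue_mat_carrier[of m j r M] glue_vec_carrier[of m j x x']
      by (simp add: scalar_prod_def lessThan_atLeast0)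
    also have "\<dots> = (\<Sum>k<Suc m. glue_mat m j r M $$ (i, k) * x $ k) +
      (\<Sum>k<m. glue_mat m j r M $$ (i, Suc m + k) * x' $ transpose j m k)"
      unfolding sum_lessThan_add
      by (intro arg_cong2[of _ _ _ _ "(+)"] sum.cong refl) (auto simp: glue_vec_def)
    finally show ?thesis .
  qed
  have eq': "(\<Sum>k<Suc m. M $$ (r, k) * x $ k) = (\<Sum>k<Suc m. M $$ (r, k) * x' $ k)"
    using eq Mv[OF x r] Mv[OF x' r] by simp
  have glue: "(\<Sum>k<Suc m. a j * M $$ (r, k) / M $$ (r, j) * x $ k) +
      (\<Sum>k<m. (a (transpose j m k) - a j * M $$ (r, transpose j m k) / M $$ (r, j)) * x' $ transpose j m k) =
      (\<Sum>k<Suc m. a k * x' $ k)" for a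
    using sum_glue[where c = "\<lambda>k. M $$ (r, k)" and x = "\<lambda>k. x $ k" and x' = "\<lambda>k. x' $ k", OF j nz eq'] .
  show "(glue_mat m j r M *\<^sub>v glue_vec m j x x') $ i = (if i = r then x' $ j else (M *\<^sub>v x) $ i)"
    if i: "i < Suc m"
  proof (cases "i = r")
    case True
    \<comment> \<open>The functional for row \<open>r\<close> is the coordinate at \<open>j\<close>,
      so this row restores the entry that \<open>glue_vec\<close> drops.\<close>
    let ?a = "\<lambda>l. if l = j then 1 else (0 :: 'k)"
    have "(glue_mat m j r M *\<^sub>v glue_vec m j x x') $ i = (\<Sum>k<Suc m. ?a k * x' $ k)"
      unfolding glue[of ?a, symmetric] G[OF trans_less_add1[OF i]]
      using True r by (intro arg_cong2[of _ _ _ _ "(+)"] sum.cong refl) (auto simp: glue_mat_def Let_def)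
    also have "\<dots> = (\<Sum>k<Suc m. if k = j then x' $ k else 0)"
      by (intro sum.cong) auto
    also have "\<dots> = x' $ j"
      using j by (subst sum.delta) auto
    finally show ?thesis using True by simp
  next
    case False
    have "(glue_mat m j r M *\<^sub>v glue_vec m j x x') $ i = (\<Sum>k<Suc m. M $$ (i, k) * x $ k) + (\<Sum>k<m. 0)"
      unfolding G[OF trans_less_add1[OF i]]
      using False i by (intro arg_cong2[of _ _ _ _ "(+)"] sum.cong refl) (auto simp: glue_mat_def)
    then show ?thesis using False i x Mv by simp
  qed
  show "(glue_mat m j r M *\<^sub>v glue_vec m j x x') $ (Suc m + l) = (M *\<^sub>v x') $ transpose r m l"
    if l: "l < m"
  proof -
    have t: "transpose r m l < Suc m" using l r by (auto simp: transpose_def)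
    have l': "Suc m + l < Suc m + m" using l by simp
    let ?a = "\<lambda>k. M $$ (transpose r m l, k)"
    have "(glue_mat m j r M *\<^sub>v glue_vec m j x x') $ (Suc m + l) = (\<Sum>k<Suc m. ?a k * x' $ k)"
      unfolding glue[of ?a, symmetric] G[OF l']
      using l r by (intro arg_cong2[of _ _ _ _ "(+)"] sum.cong refl) (auto simp: glue_mat_def Let_def)
    then show ?thesis using Mv[OF x' t] by simp
  qed
qed

lemma glue_vec_surj:
  fixes M :: "'k::field mat"
  assumes M: "M \<in> carrier_mat (Suc m) (Suc m)" and j: "j < Suc m" and r: "r < Suc m"
    and nz: "M $$ (r, j) \<noteq> 0" and X: "X \<in> carrier_vec (Suc m + m)"
  obtains x x' where "x \<in> carrier_vec (Suc m)" "x' \<in> carrier_vec (Suc m)"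
    "(M *\<^sub>v x) $ r = (M *\<^sub>v x') $ r" "X = glue_vec m j x x'"
proof -
  define x where "x = vec (Suc m) (\<lambda>k. X $ k)"
  \<comment> \<open>The value of the dropped entry that solves the constraint; the division is
    possible by \<open>nz\<close>.\<close>
  define s where "s = ((M *\<^sub>v x) $ r - (\<Sum>k\<in>{..<Suc m} - {j}. M $$ (r, k) * X $ (Suc m + transpose j m k))) / M $$ (r, j)"
  define x' where "x' = vec (Suc m) (\<lambda>k. if k = j then s else X $ (Suc m + transpose j m k))"
  have "(M *\<^sub>v x') $ r = (\<Sum>k<Suc m. M $$ (r, k) * x' $ k)"
    using M r by (simp add: x'_def scalar_prod_def lessThan_atLeast0)
  also have "\<dots> = M $$ (r, j) * x' $ j + (\<Sum>k\<in>{..<Suc m} - {j}. M $$ (r, k) * x' $ k)"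
    using j by (intro sum.remove) auto
  also have "\<dots> = M $$ (r, j) * s + (\<Sum>k\<in>{..<Suc m} - {j}. M $$ (r, k) * X $ (Suc m + transpose j m k))"
    using j by (intro arg_cong2[of _ _ _ _ "(+)"] sum.cong refl) (auto simp: x'_def)
  also have "\<dots> = (M *\<^sub>v x) $ r" using nz by (simp add: s_def)
  finally have "(M *\<^sub>v x) $ r = (M *\<^sub>v x') $ r" ..
  moreover have "X = glue_vec m j x x'"
  proof (rule eq_vecI)
    fix k assume "k < dim_vec (glue_vec m j x x')"
    then have k: "k < Suc m + m" by (simp add: glue_vec_def)
    show "X $ k = glue_vec m j x x' $ k"
    proof (cases "k < Suc m")
      case False
      then have "k - Suc m < m" using k by simp
      then have "transpose j m (k - Suc m) < Suc m" "transpose j m (k - Suc m) \<noteq> j"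
        using bij_betw_transpose_lessThan[OF j] by (auto simp: bij_betw_def)
      then show ?thesis using False k by (simp add: glue_vec_def x'_def)
    qed (use k in \<open>simp add: glue_vec_def x_def\<close>)
  qed (use X in \<open>simp add: glue_vec_def\<close>)
  moreover have "x \<in> carrier_vec (Suc m)" "x' \<in> carrier_vec (Suc m)"
    by (simp_all add: x_def x'_def)
  ultimately show thesis by (intro that[of x x'])
qed

text \<open>All entries other than \<open>x' $ j\<close> are stored in the glued vector, and this
  one is recovered from it by row \<open>r\<close> of \<open>glue_mat\<close>.\<close>

lemma glue_vec_inject:
  fixes M :: "'k::field mat"
  assumes M: "M \<in> carrier_mat (Suc m) (Suc m)" and j: "j < Suc m" and r: "r < Suc m"
    and nz: "M $$ (r, j) \<noteq> 0"
    and c: "x \<in> carrier_vec (Suc m)" "x' \<in> carrier_vec (Suc m)" "y \<in> carrier_vec (Suc m)" "y' \<in> carrier_vec (Suc m)"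
    and x: "(M *\<^sub>v x) $ r = (M *\<^sub>v x') $ r" and y: "(M *\<^sub>v y) $ r = (M *\<^sub>v y') $ r"
    and eq: "glue_vec m j x x' = glue_vec m j y y'"
  shows "x = y \<and> x' = y'"
proof -
  have *: "glue_vec m j x x' $ k = glue_vec m j y y' $ k" for k using eq by simp
  have "x $ k = y $ k" if "k < Suc m" for k
    using *[of k] that by (simp add: glue_vec_def)
  then have xy: "x = y" using c by (intro eq_vecI) auto
  have "x' $ k = y' $ k" if "k < Suc m" for k
  proof (cases "k = j")
    case True
    have "x' $ j = (glue_mat m j r M *\<^sub>v glue_vec m j x x') $ r"
      using glue_mat_mult_glue_vec(1)[OF M j r c(1,2) nz x r] by simp
    also have "\<dots> = y' $ j"
      unfolding eq using glue_mat_mult_glue_vec(1)[OF M j r c(3,4) nz y r] by simp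
    finally show ?thesis using True by simp
  next
    case False
    then have "k \<in> {..<Suc m} - {j}" using that by simp
    then obtain l where l: "l < m" "k = transpose j m l"
      using bij_betw_transpose_lessThan[OF j] unfolding bij_betw_def by auto
    then show ?thesis using *[of "Suc m + l"] by (simp add: glue_vec_def)
  qed
  then have "x' = y'" using c by (intro eq_vecI) auto
  with xy show ?thesis ..
qed

text \<open>For a pair in the kernel, \<open>M *\<^sub>v x\<close> and \<open>M *\<^sub>v x'\<close>
  vanish off \<open>r\<close> and share a value \<open>s\<close> at \<open>r\<close>, so both
  vectors equal \<open>s\<close> times column \<open>r\<close> of the inverse \<open>B\<close>.
  Entry \<open>j\<close> of \<open>x'\<close> is zero while \<open>B $$ (j, r)\<close> is not, hence
  \<open>s = 0\<close>.\<close>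

lemma invertible_glue_mat:
  fixes M :: "'k::field mat"
  assumes M: "M \<in> carrier_mat (Suc m) (Suc m)" and j: "j < Suc m" and r: "r < Suc m"
    and B: "B \<in> carrier_mat (Suc m) (Suc m)" and BM: "B * M = 1\<^sub>m (Suc m)"
    and nz: "M $$ (r, j) \<noteq> 0" "B $$ (j, r) \<noteq> 0"
  shows "invertible_mat (glue_mat m j r M)"
  unfolding invertible_mat_iff_kernel[OF glue_mat_carrier]
proof (intro ballI impI)
  fix X :: "'k vec" assume X: "X \<in> carrier_vec (Suc m + m)" and 0: "glue_mat m j r M *\<^sub>v X = 0\<^sub>v (Suc m + m)"
  obtain x x' where x: "x \<in> carrier_vec (Suc m)" "x' \<in> carrier_vec (Suc m)"
    and eq: "(M *\<^sub>v x) $ r = (M *\<^sub>v x') $ r" and Xeq: "X = glue_vec m j x x'"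
    using glue_vec_surj[OF M j r nz(1) X] .
  note G = glue_mat_mult_glue_vec[OF M j r x nz(1) eq, folded Xeq, unfolded 0]
  have x'j: "x' $ j = 0" using G(1)[OF r] r by simp
  have Mx: "(M *\<^sub>v x) $ i = 0" if "i < Suc m" "i \<noteq> r" for i
    using G(1)[OF that(1)] that by simp
  have Mx': "(M *\<^sub>v x') $ i = 0" if "i < Suc m" "i \<noteq> r" for i
  proof -
    have "i \<in> {..<Suc m} - {r}" using that by simp
    then obtain l where l: "l < m" "i = transpose r m l"
      using bij_betw_transpose_lessThan[OF r] unfolding bij_betw_def by auto
    then show ?thesis using G(2)[OF l(1)] by simp
  qed
  have solve: "y = s \<cdot>\<^sub>v col B r"
    if y: "y \<in> carrier_vec (Suc m)" and 0: "\<And>i. i < Suc m \<Longrightarrow> i \<noteq> r \<Longrightarrow> (M *\<^sub>v y) $ i = 0"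
      and s: "(M *\<^sub>v y) $ r = s" for y s
  proof -
    have My: "M *\<^sub>v y = s \<cdot>\<^sub>v unit_vec (Suc m) r"
      using 0 M r s by (intro eq_vecI) (auto simp: unit_vec_def)
    have "y = (B * M) *\<^sub>v y" using y BM by simp
    also have "\<dots> = B *\<^sub>v (s \<cdot>\<^sub>v unit_vec (Suc m) r)"
      using B M y My by (simp add: assoc_mult_mat_vec)
    also have "\<dots> = s \<cdot>\<^sub>v col B r"
      using B r by (intro eq_vecI) (auto simp: mult.commute)
    finally show ?thesis .
  qed
  define s where "s = (M *\<^sub>v x') $ r"
  have x's: "x' = s \<cdot>\<^sub>v col B r"
    using x(2) Mx' s_def[symmetric] by (rule solve)
  have "x = s \<cdot>\<^sub>v col B r"
    using x(1) Mx eq[folded s_def] by (rule solve)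
  then have xx': "x = x'" unfolding x's .
  have "s * B $$ (j, r) = 0"
    using x'j B j r unfolding x's by simp
  then have "x' = 0\<^sub>v (Suc m)"
    unfolding x's using nz B by auto
  then show "X = 0\<^sub>v (Suc m + m)"
    unfolding Xeq xx' using bij_betw_transpose_lessThan[OF j]
    by (intro eq_vecI) (auto simp: glue_vec_def bij_betw_def transpose_def)
qed

section \<open>Divisibility of the glued product by p\<close>

definition critical_prod :: "nat \<Rightarrow> nat \<Rightarrow> 'p::prime_card mod_ring mat \<Rightarrow> 'p mod_ring vec \<Rightarrow> complex" where
  "critical_prod n r M x =
     (\<Prod>i<n. 1 - add_char (x $ i)) * (\<Prod>i\<in>{..<n} - {r}. 1 - add_char ((M *\<^sub>v x) $ i))"

lemma critical_prod_nonzero_iff: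
  "critical_prod n r M x \<noteq> 0 \<longleftrightarrow>
     (\<forall>i<n. x $ i \<noteq> 0) \<and> (\<forall>i<n. i \<noteq> r \<longrightarrow> (M *\<^sub>v x) $ i \<noteq> 0)"
proof -
  have "1 - add_char a \<noteq> 0 \<longleftrightarrow> a \<noteq> 0" for a :: "'a mod_ring"
    using add_char_eq_1_iff[of a] by auto
  then show ?thesis by (auto simp: critical_prod_def)
qed

text \<open>The point is that a function with integer values has this transform. The witness is the
  group ring product without the factor of row \<open>r\<close>.\<close>

lemma critical_prod_fourier:
  fixes M :: "'p::prime_card mod_ring mat"
  assumes M: "M \<in> carrier_mat n n"
  obtains f where "\<And>x. x \<in> carrier_vec n \<Longrightarrow> fourier n f x = critical_prod n r M x"
proof
  let ?R = "vec_group_ring TYPE(int) TYPE('p mod_ring) n"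
  let ?f = "(\<Otimes>\<^bsub>?R\<^esub>i\<in>{..<n}. \<one>\<^bsub>?R\<^esub> \<ominus>\<^bsub>?R\<^esub> group_elem (unit_vec n i)) \<otimes>\<^bsub>?R\<^esub>
    (\<Otimes>\<^bsub>?R\<^esub>i\<in>{..<n} - {r}. \<one>\<^bsub>?R\<^esub> \<ominus>\<^bsub>?R\<^esub> group_elem (row M i))"
  fix x :: "'p mod_ring vec" assume x: "x \<in> carrier_vec n"
  have "fourier n ?f x = (\<Prod>i<n. 1 - add_char (x \<bullet> unit_vec n i)) *
      (\<Prod>i\<in>{..<n} - {r}. 1 - add_char (x \<bullet> row M i))"
    using M x by (intro fourier_mult_finprod) auto
  also have "\<dots> = critical_prod n r M x"
    unfolding critical_prod_def
    using M x by (intro arg_cong2[of _ _ _ _ "(*)"] prod.cong refl)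
      (auto simp: comm_scalar_prod[of x n])
  finally show "fourier n ?f x = critical_prod n r M x" .
qed

text \<open>The coordinates contribute all entries of \<open>x\<close> and those of
  \<open>x'\<close> other than \<open>j\<close>; the rows contribute the missing
  \<open>x' $ j\<close> and all rows but \<open>r\<close> for both vectors. Regrouped, these are the
  two critical products.\<close>

lemma fourier_glue_mat:
  fixes M :: "'p::prime_card mod_ring mat"
  assumes M: "M \<in> carrier_mat (Suc m) (Suc m)" and j: "j < Suc m" and r: "r < Suc m"
    and x: "x \<in> carrier_vec (Suc m)" and x': "x' \<in> carrier_vec (Suc m)"
    and nz: "M $$ (r, j) \<noteq> 0" and eq: "(M *\<^sub>v x) $ r = (M *\<^sub>v x') $ r"
  shows "fourier (Suc m + m) (basis_row_product TYPE(int) (Suc m + m) (glue_mat m j r M)) (glue_vec m j x x') =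
           critical_prod (Suc m) r M x * critical_prod (Suc m) r M x'"
proof -
  let ?g = "\<lambda>a :: 'p mod_ring. 1 - add_char a"
  note G = glue_mat_mult_glue_vec[OF M j r x x' nz eq]
  have "(\<Prod>i<Suc m + m. ?g (glue_vec m j x x' $ i)) =
      (\<Prod>i<Suc m. ?g (x $ i)) * (\<Prod>i<m. ?g (x' $ transpose j m i))"
    unfolding prod_lessThan_add
    by (intro arg_cong2[of _ _ _ _ "(*)"] prod.cong refl) (auto simp: glue_vec_def)
  also have "(\<Prod>i<m. ?g (x' $ transpose j m i)) = (\<Prod>i\<in>{..<Suc m} - {j}. ?g (x' $ i))"
    by (rule prod.reindex_bij_betw[OF bij_betw_transpose_lessThan[OF j]])
  finally have 1: "(\<Prod>i<Suc m + m. ?g (glue_vec m j x x' $ i)) =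
      (\<Prod>i<Suc m. ?g (x $ i)) * (\<Prod>i\<in>{..<Suc m} - {j}. ?g (x' $ i))" .
  have "(\<Prod>i<Suc m + m. ?g ((glue_mat m j r M *\<^sub>v glue_vec m j x x') $ i)) =
      (\<Prod>i<Suc m. ?g (if i = r then x' $ j else (M *\<^sub>v x) $ i)) * (\<Prod>i<m. ?g ((M *\<^sub>v x') $ transpose r m i))"
    unfolding prod_lessThan_add
    by (intro arg_cong2[of _ _ _ _ "(*)"] prod.cong refl) (simp_all only: G lessThan_iff)
  also have "(\<Prod>i<m. ?g ((M *\<^sub>v x') $ transpose r m i)) = (\<Prod>i\<in>{..<Suc m} - {r}. ?g ((M *\<^sub>v x') $ i))"
    by (rule prod.reindex_bij_betw[OF bij_betw_transpose_lessThan[OF r]])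
  also have "(\<Prod>i<Suc m. ?g (if i = r then x' $ j else (M *\<^sub>v x) $ i)) =
      ?g (x' $ j) * (\<Prod>i\<in>{..<Suc m} - {r}. ?g ((M *\<^sub>v x) $ i))"
    using r by (subst prod.remove[of _ r]) (auto intro!: prod.cong)
  finally have 2: "(\<Prod>i<Suc m + m. ?g ((glue_mat m j r M *\<^sub>v glue_vec m j x x') $ i)) =
      ?g (x' $ j) * (\<Prod>i\<in>{..<Suc m} - {r}. ?g ((M *\<^sub>v x) $ i)) * (\<Prod>i\<in>{..<Suc m} - {r}. ?g ((M *\<^sub>v x') $ i))" .
  have 3: "(\<Prod>i<Suc m. ?g (x' $ i)) = ?g (x' $ j) * (\<Prod>i\<in>{..<Suc m} - {j}. ?g (x' $ i))"
    using j by (intro prod.remove) auto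
  show ?thesis
    unfolding fourier_basis_row_product[OF glue_mat_carrier glue_vec_carrier] critical_prod_def 1 2 3
    by (simp only: mult_ac)
qed

lemma glue_vec_scalar_prod:
  fixes w :: "'k::field vec"
  assumes j: "j < Suc m" and w: "w \<in> carrier_vec (Suc m + m)"
  obtains y y' where "y \<in> carrier_vec (Suc m)" "y' \<in> carrier_vec (Suc m)"
    "\<And>x x'. x \<in> carrier_vec (Suc m) \<Longrightarrow> x' \<in> carrier_vec (Suc m) \<Longrightarrow>
       glue_vec m j x x' \<bullet> w = x \<bullet> y + x' \<bullet> y'"
proof
  let ?y = "vec (Suc m) (\<lambda>k. w $ k)"
  \<comment> \<open>Entry \<open>j\<close> is 0 because \<open>x' $ j\<close> is not a coordinate of
    the glued vector.\<close>
  let ?y' = "vec (Suc m) (\<lambda>k. if k = j then 0 else w $ (Suc m + transpose j m k))"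
  show "?y \<in> carrier_vec (Suc m)" "?y' \<in> carrier_vec (Suc m)" by simp_all
  fix x x' :: "'k vec" assume x: "x \<in> carrier_vec (Suc m)" "x' \<in> carrier_vec (Suc m)"
  have "x' \<bullet> ?y' = (\<Sum>k<Suc m. x' $ k * ?y' $ k)"
    by (simp add: scalar_prod_def lessThan_atLeast0)
  also have "\<dots> = x' $ j * ?y' $ j + (\<Sum>k\<in>{..<Suc m} - {j}. x' $ k * ?y' $ k)"
    using j by (intro sum.remove) auto
  also have "\<dots> = (\<Sum>k\<in>{..<Suc m} - {j}. x' $ k * w $ (Suc m + transpose j m k))"
    using j by (auto intro!: sum.cong)
  also have "\<dots> = (\<Sum>k<m. x' $ transpose j m k * w $ (Suc m + transpose j m (transpose j m k)))"
    by (rule sum.reindex_bij_betw[OF bij_betw_transpose_lessThan[OF j], symmetric])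
  finally have "x' \<bullet> ?y' = (\<Sum>k<m. x' $ transpose j m k * w $ (Suc m + k))" by simp
  moreover have "x \<bullet> ?y = (\<Sum>k<Suc m. x $ k * w $ k)"
    by (simp add: scalar_prod_def lessThan_atLeast0)
  moreover have "glue_vec m j x x' \<bullet> w = (\<Sum>k<Suc m + m. glue_vec m j x x' $ k * w $ k)"
    using w by (simp add: scalar_prod_def lessThan_atLeast0)
  moreover have "\<dots> = (\<Sum>k<Suc m. x $ k * w $ k) + (\<Sum>k<m. x' $ transpose j m k * w $ (Suc m + k))"
    unfolding sum_lessThan_add
    by (intro arg_cong2[of _ _ _ _ "(+)"] sum.cong refl) (auto simp: glue_vec_def)
  ultimately show "glue_vec m j x x' \<bullet> w = x \<bullet> ?y + x' \<bullet> ?y'" by simp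
qed

text \<open>Inversion over the glued space is a sum over pairs that factors into two inversions over
  the original space. Each coefficient is thus p times a product of two integers \<open>Q y\<close>
  and \<open>Q y'\<close>.\<close>

lemma basis_row_product_glue_mat_dvd:
  fixes M :: "'p::prime_card mod_ring mat"
  assumes M: "M \<in> carrier_mat (Suc m) (Suc m)" and j: "j < Suc m" and r: "r < Suc m"
    and nz: "M $$ (r, j) \<noteq> 0"
    and bad: "\<forall>x\<in>carrier_vec (Suc m). (\<forall>i<Suc m. x $ i \<noteq> 0) \<longrightarrow> (\<exists>i<Suc m. (M *\<^sub>v x) $ i = 0)"
    and w: "w \<in> carrier_vec (Suc m + m)"
  shows "int CARD('p) dvd basis_row_product TYPE(int) (Suc m + m) (glue_mat m j r M) w"
proof -
  let ?V = "carrier_vec (Suc m) :: 'p mod_ring vec set" and ?N = "Suc m + m"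
  let ?b = "basis_row_product TYPE(int) ?N (glue_mat m j r M)"
  let ?q = "critical_prod (Suc m) r M"
  let ?p = "of_nat CARD('p) :: complex"
  define G where "G = {(x, x'). x \<in> ?V \<and> x' \<in> ?V \<and> (M *\<^sub>v x) $ r = (M *\<^sub>v x') $ r}"
  obtain Q where Q: "\<And>x. x \<in> ?V \<Longrightarrow> fourier (Suc m) Q x = ?q x"
    using critical_prod_fourier[OF M, where r = r] by blast
  obtain y y' where y: "y \<in> ?V" "y' \<in> ?V"
    and yw: "\<And>x x'. x \<in> ?V \<Longrightarrow> x' \<in> ?V \<Longrightarrow> glue_vec m j x x' \<bullet> w = x \<bullet> y + x' \<bullet> y'"
    using glue_vec_scalar_prod[OF j w] by blast
  \<comment> \<open>Where \<open>?q\<close> is nonzero, row \<open>r\<close> is the only place left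
    for the zero that \<open>bad\<close> demands.\<close>
  have q0: "(M *\<^sub>v x) $ r = 0" if "x \<in> ?V" "?q x \<noteq> 0" for x
    using that bad unfolding critical_prod_nonzero_iff by blast
  have bij: "bij_betw (\<lambda>(x, x'). glue_vec m j x x') G (carrier_vec ?N)"
    unfolding bij_betw_def
  proof
    show "inj_on (\<lambda>(x, x'). glue_vec m j x x') G"
    proof (rule inj_onI)
      fix a b assume a: "a \<in> G" and b: "b \<in> G"
        and eq: "(case a of (x, x') \<Rightarrow> glue_vec m j x x') = (case b of (x, x') \<Rightarrow> glue_vec m j x x')"
      obtain x x' y y' where ab: "a = (x, x')" "b = (y, y')" by (cases a, cases b)
      have "x = y \<and> x' = y'"
        using a b eq unfolding ab G_def by (intro glue_vec_inject[OF M j r nz]) simp_all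
      then show "a = b" by (simp add: ab)
    qed
    show "(\<lambda>(x, x'). glue_vec m j x x') ` G = carrier_vec ?N"
    proof (intro equalityI subsetI)
      fix X :: "'p mod_ring vec" assume "X \<in> carrier_vec ?N"
      then show "X \<in> (\<lambda>(x, x'). glue_vec m j x x') ` G"
        by (rule glue_vec_surj[OF M j r nz]) (force simp: G_def)
    qed (auto simp: glue_vec_def)
  qed
  have "?p ^ ?N * of_int (?b w) = (\<Sum>X\<in>carrier_vec ?N. add_char (- (X \<bullet> w)) * fourier ?N ?b X)"
    by (rule fourier_inversion[OF w, symmetric])
  also have "\<dots> = (\<Sum>(x, x')\<in>G. add_char (- (glue_vec m j x x' \<bullet> w)) * fourier ?N ?b (glue_vec m j x x'))"
    unfolding case_prod_unfold by (rule sum.reindex_bij_betw[OF bij[unfolded case_prod_unfold], symmetric])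
  also have "\<dots> = (\<Sum>(x, x')\<in>G. (add_char (- (x \<bullet> y)) * ?q x) * (add_char (- (x' \<bullet> y')) * ?q x'))"
    using fourier_glue_mat[OF M j r _ _ nz]
    by (intro sum.cong) (auto simp: G_def yw add_char_minus_add simp del: minus_add_distrib)
  also have "\<dots> = (\<Sum>(x, x')\<in>?V \<times> ?V. (add_char (- (x \<bullet> y)) * ?q x) * (add_char (- (x' \<bullet> y')) * ?q x'))"
  proof (rule sum.mono_neutral_left)
    show "\<forall>a\<in>?V \<times> ?V - G. (case a of (x, x') \<Rightarrow>
        (add_char (- (x \<bullet> y)) * ?q x) * (add_char (- (x' \<bullet> y')) * ?q x')) = 0"
    proof
      fix a assume a: "a \<in> ?V \<times> ?V - G"
      obtain x x' where xx': "a = (x, x')" by (cases a)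
      have "(M *\<^sub>v x) $ r \<noteq> (M *\<^sub>v x') $ r" and V: "x \<in> ?V" "x' \<in> ?V"
        using a by (auto simp: xx' G_def)
      then have "?q x = 0 \<or> ?q x' = 0"
        using q0[OF V(1)] q0[OF V(2)] by metis
      then show "(case a of (x, x') \<Rightarrow>
          (add_char (- (x \<bullet> y)) * ?q x) * (add_char (- (x' \<bullet> y')) * ?q x')) = 0"
        by (auto simp: xx')
    qed
  qed (auto simp: G_def)
  also have "\<dots> = (\<Sum>x\<in>?V. add_char (- (x \<bullet> y)) * ?q x) * (\<Sum>x'\<in>?V. add_char (- (x' \<bullet> y')) * ?q x')"
    by (simp add: sum_product sum.cartesian_product)
  also have "\<dots> = (?p ^ Suc m * of_int (Q y)) * (?p ^ Suc m * of_int (Q y'))"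
    unfolding fourier_inversion[OF y(1), symmetric] fourier_inversion[OF y(2), symmetric]
    by (simp add: Q)
  \<comment> \<open>The right-hand side has exponent 2m + 2 against 2m + 1 on the left, which leaves
    one factor p.\<close>
  finally have "?p ^ ?N * of_int (?b w) = ?p ^ ?N * of_int (int CARD('p) * (Q y * Q y'))"
    by (simp add: power_add mult_ac)
  moreover have "?p ^ ?N \<noteq> 0" by simp
  ultimately have "(of_int (?b w) :: complex) = of_int (int CARD('p) * (Q y * Q y'))"
    by (metis mult_left_cancel)
  then have "?b w = int CARD('p) * (Q y * Q y')"
    unfolding of_int_eq_iff .
  then show ?thesis by simp
qed

section \<open>Contradiction from the glued matrix\<close>

theorem theoremC:
  fixes p :: nat
  assumes "prime p" and "3 < p" and "CARD('p::prime_card) = p"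
    and "\<forall>n\<ge>1. \<forall>M \<in> carrier_mat n n. invertible_mat (M :: 'p mod_ring mat) \<longrightarrow>
           basis_row_product TYPE('p mod_ring) n M
             = \<zero>\<^bsub>vec_group_ring TYPE('p mod_ring) TYPE('p mod_ring) n\<^esub> \<longrightarrow>
           basis_row_product TYPE(int) n M
             = \<zero>\<^bsub>vec_group_ring TYPE(int) TYPE('p mod_ring) n\<^esub>"
  shows "\<forall>n\<ge>1. \<forall>M \<in> carrier_mat n n. invertible_mat (M :: 'p mod_ring mat) \<longrightarrow>
           (\<exists>x \<in> carrier_vec n. (\<forall>i<n. x $ i \<noteq> 0) \<and> (\<forall>i<n. (M *\<^sub>v x) $ i \<noteq> 0))"
proof (intro allI impI ballI, rule ccontr)
  fix n :: nat and M\<^sub>0 :: "'p mod_ring mat"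
  assume n: "1 \<le> n" and M\<^sub>0: "M\<^sub>0 \<in> carrier_mat n n" "invertible_mat M\<^sub>0"
    and "\<not> (\<exists>x\<in>carrier_vec n. (\<forall>i<n. x $ i \<noteq> 0) \<and> (\<forall>i<n. (M\<^sub>0 *\<^sub>v x) $ i \<noteq> 0))"
  then have "\<forall>x\<in>carrier_vec n. (\<forall>i<n. x $ i \<noteq> 0) \<longrightarrow> (\<exists>i<n. (M\<^sub>0 *\<^sub>v x) $ i = 0)"
    by blast
  note critical_counterexample[OF M\<^sub>0 this]
  then obtain M :: "'p mod_ring mat" and r x where
    M: "M \<in> carrier_mat n n" "invertible_mat M"
    and bad: "\<forall>x\<in>carrier_vec n. (\<forall>i<n. x $ i \<noteq> 0) \<longrightarrow> (\<exists>i<n. (M *\<^sub>v x) $ i = 0)"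
    and r: "r < n" and x: "x \<in> carrier_vec n" "\<forall>i<n. x $ i \<noteq> 0" "\<forall>i<n. i \<noteq> r \<longrightarrow> (M *\<^sub>v x) $ i \<noteq> 0"
    by blast
  obtain m where m: "n = Suc m" using n by (cases n) auto
  obtain B where B: "B \<in> carrier_mat n n" "B * M = 1\<^sub>m n" "M * B = 1\<^sub>m n"
    using invertible_mat_obtain_inverse[OF M] .
  \<comment> \<open>The diagonal entry at \<open>r\<close> of \<open>M * B\<close> is 1, so some
    term of its expansion is nonzero. This one \<open>j\<close> serves both the elimination of
    \<open>x' $ j\<close> and the invertibility of the glued matrix.\<close>
  have "(\<Sum>j<n. M $$ (r, j) * B $$ (j, r)) = (M * B) $$ (r, r)"
    using M B(1) r by (simp add: scalar_prod_def lessThan_atLeast0)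
  also have "\<dots> \<noteq> 0" using r by (simp add: B(3))
  finally obtain j where j: "j < n" and nz: "M $$ (r, j) \<noteq> 0" "B $$ (j, r) \<noteq> 0"
    by (metis (no_types, lifting) lessThan_iff mult_zero_left mult_zero_right sum.neutral)
  let ?N = "Suc m + m" and ?M = "glue_mat m j r M"
  let ?b = "basis_row_product TYPE(int) ?N ?M"
  have dvd: "int CARD('p) dvd ?b w" for w
  proof (cases "w \<in> carrier_vec ?N")
    case True
    then show ?thesis
      using M(1) j r nz(1) bad unfolding m by (intro basis_row_product_glue_mat_dvd)
  next
    case False
    then have "?b w = 0"
      using basis_row_product_closed[where 'r = int, OF glue_mat_carrier[of m j r M]]
      by (auto simp: group_ring_carrier_iff monoid_vec_def)
    then show ?thesis by simp
  qed
  have "basis_row_product TYPE('p mod_ring) ?N ?M = (\<lambda>w. 0)"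
  proof
    fix w
    obtain k where "?b w = int CARD('p) * k" using dvd[of w] by (elim dvdE)
    then show "basis_row_product TYPE('p mod_ring) ?N ?M w = 0"
      unfolding basis_row_product_of_int[where 'r = "'p mod_ring", OF glue_mat_carrier] by simp
  qed
  moreover have "invertible_mat ?M"
    using invertible_glue_mat M(1) j r B nz unfolding m by blast
  \<comment> \<open>The assumed statement is applied in dimension 2n - 1.\<close>
  ultimately have "?b = (\<lambda>w. 0)"
    using assms(4)[rule_format, of ?N ?M] glue_mat_carrier[of m j r M] by (simp add: group_ring_simps)
  \<comment> \<open>The diagonal pair \<open>(x, x)\<close> satisfies the gluing constraint
    trivially, and there the transform is the square of a nonzero critical product.\<close>
  then have "fourier ?N ?b (glue_vec m j x x) = 0"
    by (simp add: fourier_def)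
  moreover have "fourier ?N ?b (glue_vec m j x x) = critical_prod n r M x * critical_prod n r M x"
    using fourier_glue_mat[of M m j r x x] M(1) j r x(1) nz(1) unfolding m by blast
  ultimately show False
    using critical_prod_nonzero_iff[of n r M x] x by simp
qed

end
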